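(* There exists $\delta>0$ such that, as $r=2N+1\to\infty$ ranges over odd integers $r>3$, $$TV_r\left(\mathbb{S}^3\setminus4_1,e^{\frac{2\pi i}{r}}\right)\ \sim\ (\eta_r')^2\sum_{M:\ 1-\delta\le\frac{M}{N+1/2}\le1}\left|\tilde J_M\left(4_1,e^{\frac{2\pi i}{N+\frac12}}\right)\right|^2$$ and $$TV_r\left(\mathbb{S}^3\setminus4_1,e^{\frac{2\pi i}{r}}\right)\ \sim\ \frac14\left(\frac r2\right)^{1/2}\left|\frac{2}{\sqrt{-3}}\right|^{3/2}\exp\left(\frac{r}{2\pi}\operatorname{Vol}(\mathbb{S}^3\setminus4_1)\right).$$ (Here $\frac{2}{\sqrt{-3}}$ is the twisted Reidemeister torsion associated with the unique complete hyperbolic structure of $\mathbb{S}^3\setminus4_1$.)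
   Context: $A\sim B$ means the ratio tends to $1$. $M$ denotes integers with $1\le M\le N$. $\eta_r'=\frac{2\sin(2\pi/r)}{\sqrt r}$. The unnormalized colored Jones polynomial is $\tilde J_M(4_1,q)=\frac{q^{M/2}-q^{-M/2}}{q^{1/2}-q^{-1/2}}J_M(4_1;q)$, where $$J_M(4_1;q)=1+\sum_{k=1}^{M-1}\prod_{l=1}^{k}\left(q^{\frac{M-l}{2}}-q^{-\frac{M-l}{2}}\right)\left(q^{\frac{M+l}{2}}-q^{-\frac{M+l}{2}}\right)$$ and for $q=e^{\eta}$ one sets $q^x=e^{x\eta}$. $TV_r(\mathbb{S}^3\setminus4_1,e^{2\pi i/r})$ is the $r$-th Turaev–Viro invariant of the figure eight knot complement at the root $e^{2\pi i/r}$, $r=2N+1$ odd. By a known theorem of Detcherry–Kalfagianni–Yang (which determines it completely and may be used as its definition here), $$TV_r\left(\mathbb{S}^3\setminus4_1,e^{\frac{2\pi i}{r}}\right)=(\eta_r')^2\sum_{M=1}^{N}\left|\tilde J_M\left(4_1,e^{\frac{2\pi i}{N+\frac12}}\right)\right|^2 .$$ $\operatorname{Vol}(\mathbb{S}^3\setminus4_1)=6\Lambda(\pi/3)=2.0298\ldots$ is the hyperbolic volume of the figure eight knot complement, with $\Lambda(\theta)=-\int_0^\theta\log|2\sin t|\,dt$. *)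

theory Defs
  imports "HOL-Analysis.Analysis" "HOL-Library.Landau_Symbols"
begin

text \<open>
  Half-integer powers of \<open>q = e\<^sup>\<eta>\<close> depend on the choice of the logarithm \<open>\<eta>\<close>,
  so \<open>\<eta>\<close> (and not \<open>q\<close>) is the parameter of all the functions below.
\<close>

definition qpow :: "complex \<Rightarrow> real \<Rightarrow> complex" where
  "qpow \<eta> x = exp (of_real x * \<eta>)"

definition colored_jones_fig8 :: "nat \<Rightarrow> complex \<Rightarrow> complex" where
  "colored_jones_fig8 M \<eta> =
     1 + (\<Sum>k = 1..M - 1. \<Prod>l = 1..k.
            (qpow \<eta> ((real M - real l) / 2) - qpow \<eta> (- ((real M - real l) / 2))) *
            (qpow \<eta> ((real M + real l) / 2) - qpow \<eta> (- ((real M + real l) / 2))))"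

definition unnormalized_jones_fig8 :: "nat \<Rightarrow> complex \<Rightarrow> complex" where
  "unnormalized_jones_fig8 M \<eta> =
     (qpow \<eta> (real M / 2) - qpow \<eta> (- (real M / 2))) / (qpow \<eta> (1 / 2) - qpow \<eta> (- (1 / 2)))
     * colored_jones_fig8 M \<eta>"

definition jones_root :: "nat \<Rightarrow> complex" where
  "jones_root N = 2 * of_real pi * \<i> / of_real (real N + 1 / 2)"

definition eta_r :: "nat \<Rightarrow> real" where
  "eta_r r = 2 * sin (2 * pi / real r) / sqrt (real r)"

text \<open>
  The \<open>r\<close>-th Turaev--Viro invariant of the figure eight knot complement at \<open>e\<^bsup>2\<pi>i/r\<^esup>\<close>,
  given by the formula of Detcherry, Kalfagianni and Yang. It is meaningful for odd \<open>r\<close>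
  only; writing \<open>r = 2N + 1\<close>, the upper summation bound is \<open>N\<close>.
\<close>

definition TV_fig8 :: "nat \<Rightarrow> real" where
  "TV_fig8 r = (let N = (r - 1) div 2 in
     (eta_r r)\<^sup>2 * (\<Sum>M = 1..N. (cmod (unnormalized_jones_fig8 M (jones_root N)))\<^sup>2))"

definition Lobachevsky :: "real \<Rightarrow> real" where
  "Lobachevsky \<theta> = - (LBINT t=0..\<theta>. ln \<bar>2 * sin t\<bar>)"

definition Vol_fig8 :: real where
  "Vol_fig8 = 6 * Lobachevsky (pi / 3)"

end

theory Submission
  imports Defs "HOL-Probability.Probability" "HOL-Real_Asymp.Real_Asymp"
begin

text \<open>
  Write \<open>n = N + 1/2\<close>, so that \<open>r = 2n\<close>, and \<open>P(K) = \<Prod>\<^bsub>j=1..K\<^esub> 2 sin (\<pi>(j - 1/2)/n)\<close>. At the root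
  \<open>e\<^bsup>2\<pi>i/n\<^esup>\<close> every factor of the colored Jones polynomial is a product of two real sines. For
  \<open>M = N - m\<close> the angle \<open>\<pi>M/n\<close> is \<open>\<pi> - a\<close> with \<open>a = \<pi>(m + 1/2)/n\<close>, so all sines are taken at half-integer
  multiples of \<open>\<pi>/n\<close> and the products telescope: up to sign, \<open>2 sin a\<close> times the \<open>k\<close>-th summand is
  \<open>P(k - m) P(k + m + 1)\<close> for \<open>k \<ge> m\<close> and \<open>P(m + k + 1) / P(m - k)\<close> for \<open>k \<le> m\<close>
  (\<open>jones_term_ge\<close>, \<open>jones_term_le\<close>). The sign is constant in the first range (the bulk) and alternates
  in the second one (the head). The factor \<open>sin a / sin (\<pi>/n)\<close> of the unnormalized polynomial
  supplies exactly this \<open>sin a\<close>, and the denominator cancels against \<open>\<eta>\<^sub>r'\<close>; hence \<open>TV\<^sub>r\<close> is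
  \<open>1/(2n)\<close> times the sum over \<open>m\<close> of the squares of head plus or minus bulk (\<open>jones_square_sum\<close>).

  The logarithm of \<open>P(K)\<close> is a midpoint sum for \<open>n/\<pi>\<close> times \<open>F(x) = \<integral>\<^bsub>0..x\<^esub> ln (2 sin t) dt\<close>, which is minus
  the Lobachevsky function; the logarithmic singularity at \<open>0\<close> contributes the constant \<open>(ln 2)/2\<close> through
  Stirling's formula. On \<open>[0, \<pi>)\<close> the function \<open>F\<close> has its maximum at \<open>5\<pi>/6\<close>, with second derivative
  \<open>-\<surd>3\<close> there, and the duplication formula for \<open>F\<close> gives \<open>4 F(5\<pi>/6) = Vol\<close>. With
  \<open>E = e\<^bsup>n F(5\<pi>/6)/\<pi>\<^esup>\<close> this yields a local limit on the scale \<open>\<surd>n\<close>: \<open>P(K)/E\<close> tends to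
  \<open>\<surd>2 exp (- (\<surd>3 \<pi>/2) y\<^sup>2)\<close> when \<open>(K - 5n/6)/\<surd>n\<close> tends to \<open>y\<close> (\<open>half_sine_prod_local_limit\<close>), together
  with a Gaussian bound for all \<open>K\<close> (\<open>half_sine_prod_gaussian_bound\<close>).

  The bulk is therefore a Gaussian Riemann sum in \<open>k\<close>. As \<open>(u - x)\<^sup>2 + (u + x)\<^sup>2 = 2u\<^sup>2 + 2x\<^sup>2\<close>, it is of
  size \<open>\<surd>n E\<^sup>2\<close> and again Gaussian in \<open>m/\<surd>n\<close>, so the sum of its squares is a second Gaussian Riemann sum,
  of size \<open>n\<^bsup>3/2\<^esup> E\<^sup>4\<close>. Only \<open>m\<close> of order \<open>\<surd>n\<close> matter, that is \<open>M/n\<close> close to \<open>1\<close>, which is the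
  first claim. Taken in absolute value, the terms of the head would add up to the same order
  for \<open>m\<close> near \<open>n/2\<close>; but they form an alternating unimodal sequence, so the head is bounded by its
  largest term, of order \<open>E\<^sup>2\<close> (\<open>jones_head_bound\<close>), and contributes only \<open>O(n E\<^sup>4)\<close>.
\<close>

section \<open>The log-sine integral\<close>

definition log_sinc :: "real \<Rightarrow> real" where
  "log_sinc x = ln (sinc x)"

definition log_sinc_integral :: "real \<Rightarrow> real" where
  "log_sinc_integral x = (LBINT t=0..x. log_sinc t)"

text \<open>
  The integral of \<open>ln (2 sin t)\<close> from \<open>0\<close> to \<open>x\<close>, the function \<open>F\<close> of the introduction.
\<close>

definition log_sine_integral :: "real \<Rightarrow> real" where
  "log_sine_integral x = - Lobachevsky x"

text \<open>
  The derivative of \<open>log_sinc\<close> on \<open>(0, \<pi>)\<close>. Division by zero makes its value at \<open>0\<close> equal to \<open>0\<close>,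
  which is also its limit there.
\<close>

definition cot_defect :: "real \<Rightarrow> real" where
  "cot_defect x = cot x - 1 / x"

lemma sinc_pos: "0 \<le> x \<Longrightarrow> x < pi \<Longrightarrow> sinc x > 0"
  using sin_gt_zero[of x] by auto

lemma isCont_log_sinc: "0 \<le> x \<Longrightarrow> x < pi \<Longrightarrow> isCont log_sinc x"
  unfolding log_sinc_def
  by (rule isCont_o2[OF isCont_sinc isCont_ln]) (use sinc_pos[of x] in linarith)

lemma log_sinc_integral_deriv_within:
  assumes "0 \<le> x" "x \<le> b" "b < pi"
  shows "(log_sinc_integral has_real_derivative log_sinc x) (at x within {0..b})"
proof -
  have "continuous_on {0..b} log_sinc"
    using assms isCont_log_sinc by (auto intro!: continuous_at_imp_continuous_on)
  from interval_integral_FTC2[of 0 0 b log_sinc x, OF _ _ this] assms show ?thesis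
    unfolding log_sinc_integral_def[abs_def] has_real_derivative_iff_has_vector_derivative
    by (simp add: zero_ereal_def)
qed

lemma log_sinc_integral_deriv:
  assumes "0 < x" "x < pi"
  shows "(log_sinc_integral has_real_derivative log_sinc x) (at x)"
proof -
  obtain b where b: "x < b" "b < pi" using assms dense by blast
  have "(log_sinc_integral has_real_derivative log_sinc x) (at x within {0..b})"
    using b assms by (intro log_sinc_integral_deriv_within) auto
  moreover have "at x within {0..b} = at x"
    using assms b by (intro at_within_interior) auto
  ultimately show ?thesis by simp
qed

lemma log_sinc_integral_continuous:
  assumes "b < pi"
  shows "continuous_on {0..b} log_sinc_integral"
  by (rule DERIV_continuous_on[where D = log_sinc], rule log_sinc_integral_deriv_within)
     (use assms in auto)

lemma log_sinc_integral_0 [simp]: "log_sinc_integral 0 = 0"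
  by (simp add: log_sinc_integral_def zero_ereal_def[symmetric])

lemma log_sinc_integral_tendsto_0: "(log_sinc_integral \<longlongrightarrow> 0) (at_right 0)"
proof -
  have "continuous (at 0 within {0..1}) log_sinc_integral"
    using log_sinc_integral_continuous[of 1] pi_gt3
    unfolding continuous_on_eq_continuous_within by simp
  then show ?thesis
    using at_within_Icc_at_right[of "0::real" 1] by (simp add: continuous_within)
qed

text \<open>
  Splitting \<open>ln (2 sin t) = ln (2t) + ln (sin t / t)\<close> isolates the singularity at \<open>0\<close> in an elementary term
  and leaves a smooth one.
\<close>

lemma log_sine_integral_eq:
  assumes "0 < x" "x < pi"
  shows "log_sine_integral x = log_sinc_integral x + x * ln (2 * x) - x"
proof -
  \<comment> \<open>The fundamental theorem for improper integrals needs an integrand of constant sign;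
    \<open>ln 2 - ln (2 sin t)\<close> is nonnegative.\<close>
  define G where "G = (\<lambda>x. x * ln 2 - (log_sinc_integral x + x * ln (2 * x) - x))"
  let ?f = "\<lambda>t. ln 2 - ln \<bar>2 * sin t\<bar>"
  have deriv: "(G has_real_derivative ?f t) (at t)" if "0 < t" "t < x" for t
  proof -
    have t: "0 < t" "t < pi" using that assms by auto
    then have "sin t > 0" by (rule sin_gt_zero)
    have "ln (sin t / t) = ln (sin t) - ln t" "ln (2 * t) = ln 2 + ln t"
      "ln \<bar>2 * sin t\<bar> = ln 2 + ln (sin t)"
      using t \<open>sin t > 0\<close> by (simp_all add: ln_div ln_mult abs_mult)
    then show ?thesis unfolding G_def
      using t by (auto intro!: derivative_eq_intros log_sinc_integral_deriv
          simp: log_sinc_def)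
  qed
  have cont: "isCont ?f t" if "0 < t" "t < x" for t
    using sin_gt_zero[of t] that assms by (intro continuous_intros) auto
  have nonneg: "0 \<le> ?f t" if "0 < t" "t < x" for t
  proof -
    have "sin t > 0" using sin_gt_zero[of t] that assms by auto
    then have "ln \<bar>2 * sin t\<bar> \<le> ln 2" by (subst ln_le_cancel_iff) auto
    then show ?thesis by simp
  qed
  have G0: "(G \<longlongrightarrow> 0) (at_right 0)"
  proof -
    have "((\<lambda>x::real. x * ln 2 - (x * ln (2 * x) - x)) \<longlongrightarrow> 0) (at_right 0)"
      by real_asymp
    from tendsto_diff[OF this log_sinc_integral_tendsto_0] show ?thesis
      unfolding G_def by (simp add: algebra_simps)
  qed
  have Gx: "(G \<longlongrightarrow> G x) (at_left x)"
  proof -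
    have "isCont G x" unfolding G_def
      using assms log_sinc_integral_deriv[of x]
      by (intro continuous_intros) (auto intro: DERIV_isCont)
    then show ?thesis
      by (simp add: isCont_def filterlim_at_split)
  qed
  have "set_integrable lborel (einterval 0 (ereal x)) ?f"
    and I: "(LBINT t=0..ereal x. ?f t) = G x - 0"
    by (rule interval_integral_FTC_nonneg[of 0 "ereal x" G];
        use assms deriv cont nonneg G0 Gx in
        \<open>auto simp: zero_ereal_def ereal_tendsto_simps\<close>)+
  then have int: "interval_lebesgue_integrable lborel 0 (ereal x) ?f"
    using assms by (simp add: interval_lebesgue_integrable_def)
  have "(LBINT t=0..ereal x. ln \<bar>2 * sin t\<bar>) = (LBINT t=0..ereal x. ln 2 - ?f t)"
    by simp
  also have "\<dots> = (LBINT t=0..ereal x. ln 2) - (LBINT t=0..ereal x. ?f t)"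
    by (rule interval_lebesgue_integral_diff(2)[OF _ int])
       (simp add: zero_ereal_def)
  also have "(LBINT t=0..ereal x. ln 2) = x * ln 2"
    using assms by (simp add: zero_ereal_def)
  finally show ?thesis
    using I unfolding log_sine_integral_def Lobachevsky_def G_def by simp
qed

lemma log_sine_integral_deriv:
  assumes "0 < x" "x < pi"
  shows "(log_sine_integral has_real_derivative ln (2 * sin x)) (at x)"
proof -
  let ?G = "\<lambda>x. log_sinc_integral x + x * ln (2 * x) - x"
  have "sin x > 0" using assms by (rule sin_gt_zero)
  then have "ln (sin x / x) = ln (sin x) - ln x" "ln (2 * x) = ln 2 + ln x"
      "ln (2 * sin x) = ln 2 + ln (sin x)"
    using assms by (simp_all add: ln_div ln_mult)
  then have "(?G has_real_derivative ln (2 * sin x)) (at x)"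
    using assms by (auto intro!: derivative_eq_intros log_sinc_integral_deriv simp: log_sinc_def)
  then show ?thesis
    by (rule has_field_derivative_transform_within_open[of _ _ _ "{0<..<pi}"])
       (use assms log_sine_integral_eq in auto)
qed

lemma log_sine_integral_isCont: "0 < x \<Longrightarrow> x < pi \<Longrightarrow> isCont log_sine_integral x"
  using log_sine_integral_deriv DERIV_isCont by blast

lemma log_sine_integral_0 [simp]: "log_sine_integral 0 = 0"
  by (simp add: log_sine_integral_def Lobachevsky_def zero_ereal_def[symmetric])

lemma log_sine_integral_tendsto_0: "(log_sine_integral \<longlongrightarrow> 0) (at_right 0)"
proof -
  have "((\<lambda>x::real. x * ln (2 * x) - x) \<longlongrightarrow> 0) (at_right 0)"
    by real_asymp
  from tendsto_add[OF log_sinc_integral_tendsto_0 this]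
  have "((\<lambda>x. log_sinc_integral x + x * ln (2 * x) - x) \<longlongrightarrow> 0) (at_right 0)"
    by (simp add: algebra_simps)
  moreover have "eventually (\<lambda>x. log_sinc_integral x + x * ln (2 * x) - x = log_sine_integral x) (at_right 0)"
    unfolding eventually_at_right_field
    by (intro exI[of _ pi]) (auto simp: log_sine_integral_eq)
  ultimately show ?thesis
    using tendsto_cong by fast
qed

lemma log_sine_integral_reflect:
  assumes "0 < x" "x < pi"
  shows "log_sine_integral x + log_sine_integral (pi - x) = 2 * log_sine_integral (pi / 2)"
proof -
  have "log_sine_integral x + log_sine_integral (pi - x) =
      log_sine_integral (pi/2) + log_sine_integral (pi - pi/2)"
  proof (rule DERIV_isconst3[of 0 pi _ _ "\<lambda>x. log_sine_integral x + log_sine_integral (pi - x)"])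
    fix y assume y: "y \<in> {0<..<pi}"
    have "((\<lambda>y. log_sine_integral (pi - y)) has_real_derivative ln (2 * sin (pi - y)) * (-1)) (at y)"
      by (rule DERIV_chain2[OF log_sine_integral_deriv]) (use y in \<open>auto intro!: derivative_eq_intros\<close>)
    then show "((\<lambda>x. log_sine_integral x + log_sine_integral (pi - x)) has_real_derivative 0) (at y)"
      using DERIV_add[OF log_sine_integral_deriv] y by fastforce
  qed (use assms in auto)
  then show ?thesis by (simp add: field_simps)
qed

text \<open>
  Both sides have the same derivative because \<open>2 sin (2x) = (2 sin x)(2 sin (x + \<pi>/2))\<close>, and the
  constant is found by letting \<open>x\<close> tend to \<open>0\<close>.
\<close>

lemma log_sine_integral_duplication:
  assumes "0 < x" "x < pi / 2"
  shows "log_sine_integral (2 * x) =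
    2 * log_sine_integral x + 2 * log_sine_integral (x + pi / 2) - 2 * log_sine_integral (pi / 2)"
proof -
  define D where "D = (\<lambda>x. log_sine_integral (2 * x) - 2 * log_sine_integral x
    - 2 * log_sine_integral (x + pi / 2))"
  have const: "D y = D x" if "0 < y" "y < pi / 2" for y
  proof (rule DERIV_isconst3[of 0 "pi/2" _ _ D])
    fix t assume t: "t \<in> {0<..<pi/2}"
    then have pos: "sin t > 0" "cos t > 0"
      using sin_gt_zero[of t] cos_gt_zero[of t] by auto
    have 1: "((\<lambda>t. log_sine_integral (2 * t)) has_real_derivative ln (2 * sin (2 * t)) * 2) (at t)"
      by (rule DERIV_chain2[OF log_sine_integral_deriv]) (use t in \<open>auto intro!: derivative_eq_intros\<close>)
    have 2: "((\<lambda>t. log_sine_integral (t + pi/2)) has_real_derivative ln (2 * sin (t + pi/2)) * 1) (at t)"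
      by (rule DERIV_chain2[OF log_sine_integral_deriv]) (use t in \<open>auto intro!: derivative_eq_intros\<close>)
    have 3: "(log_sine_integral has_real_derivative ln (2 * sin t)) (at t)"
      using t by (intro log_sine_integral_deriv) auto
    have "2 * ln (2 * sin (2 * t)) = 2 * ln (2 * sin t) + 2 * ln (2 * sin (t + pi/2))"
      using pos ln_realpow[of 2 2] by (simp add: sin_double sin_add ln_mult)
    then show "(D has_real_derivative 0) (at t)" unfolding D_def
      by (auto intro!: derivative_eq_intros 1 2 3)
  qed (use assms that in auto)
  have "(D \<longlongrightarrow> 0 - 2 * 0 - 2 * log_sine_integral (0 + pi/2)) (at_right 0)"
    unfolding D_def
  proof (intro tendsto_intros log_sine_integral_tendsto_0)
    show "((\<lambda>x. log_sine_integral (2 * x)) \<longlongrightarrow> 0) (at_right 0)"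
      by (rule filterlim_compose[OF log_sine_integral_tendsto_0]) real_asymp
    show "((\<lambda>x. log_sine_integral (x + pi/2)) \<longlongrightarrow> log_sine_integral (0 + pi/2)) (at_right 0)"
      by (rule isCont_tendsto_compose[OF log_sine_integral_isCont])
         (auto intro!: tendsto_eq_intros)
  qed
  moreover have "(D \<longlongrightarrow> D x) (at_right 0)"
  proof (rule tendsto_eventually)
    show "\<forall>\<^sub>F y in at_right 0. D y = D x"
      unfolding eventually_at_right_field using const by (intro exI[of _ "pi/2"]) auto
  qed
  ultimately have "D x = - 2 * log_sine_integral (pi/2)"
    using tendsto_unique[of "at_right (0::real)"] by fastforce
  then show ?thesis by (simp add: D_def)
qed

text \<open>
  At \<open>x = \<pi>/4\<close> duplication and reflection are two linear equations that force this value to vanish.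
\<close>

lemma log_sine_integral_half_pi: "log_sine_integral (pi / 2) = 0"
  using log_sine_integral_duplication[of "pi / 4"] log_sine_integral_reflect[of "pi / 4"]
  by (simp add: field_simps)

text \<open>
  Duplication at \<open>\<pi>/6\<close> and reflection at \<open>\<pi>/3\<close> and \<open>\<pi>/6\<close> give \<open>\<Lambda>(\<pi>/6) = 3\<Lambda>(\<pi>/3)/2\<close> for the Lobachevsky
  function \<open>\<Lambda>\<close>.
\<close>

lemma Vol_fig8_eq: "Vol_fig8 = 4 * log_sine_integral (5 * pi / 6)"
proof -
  have "log_sine_integral (pi/3) = 2 * log_sine_integral (pi/6) + 2 * log_sine_integral (2*pi/3)"
    using log_sine_integral_duplication[of "pi/6"] log_sine_integral_half_pi
    by (simp add: field_simps)
  moreover have "log_sine_integral (pi/3) + log_sine_integral (2*pi/3) = 0"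
    using log_sine_integral_reflect[of "pi/3"] log_sine_integral_half_pi
    by (simp add: field_simps)
  moreover have "log_sine_integral (pi/6) + log_sine_integral (5*pi/6) = 0"
    using log_sine_integral_reflect[of "pi/6"] log_sine_integral_half_pi
    by (simp add: field_simps)
  ultimately show ?thesis by (simp add: Vol_fig8_def log_sine_integral_def)
qed

lemma sin_5pi6: "sin (5 * pi / 6) = 1 / 2" and cos_5pi6: "cos (5 * pi / 6) = - (sqrt 3 / 2)"
proof -
  have "5 * pi / 6 = pi - pi / 6" by simp
  then show "sin (5 * pi / 6) = 1 / 2" "cos (5 * pi / 6) = - (sqrt 3 / 2)"
    by (simp_all only: sin_pi_minus cos_pi_minus sin_30 cos_30)
qed

lemma log_sine_deriv:
  assumes "0 < x" "x < pi"
  shows "((\<lambda>x. ln (2 * sin x)) has_real_derivative cot x) (at x)"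
  using sin_gt_zero[OF assms] assms by (auto intro!: derivative_eq_intros simp: cot_def field_simps)

lemma cot_antimono:
  assumes "0 < x" "x \<le> y" "y < pi"
  shows "cot y \<le> cot x"
proof -
  have pos: "sin x > 0" "sin y > 0" "sin (y - x) \<ge> 0"
    using assms by (auto intro!: sin_gt_zero sin_ge_zero)
  have "cot x - cot y = sin (y - x) / (sin x * sin y)"
    using pos by (simp add: cot_def sin_diff field_simps)
  also have "\<dots> \<ge> 0" using pos by simp
  finally show ?thesis by simp
qed

lemma log_sine_integral_mono_section:
  assumes "pi / 6 \<le> x" "x \<le> y" "y \<le> 5 * pi / 6"
  shows "log_sine_integral x \<le> log_sine_integral y"
proof (rule DERIV_nonneg_imp_nondecreasing[OF assms(2)])
  fix t assume t: "x \<le> t" "t \<le> y"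
  have t': "0 < t" "t < pi" using t assms pi_gt_zero by linarith+
  have "sin t \<ge> 1 / 2"
  proof (cases "t \<le> pi / 2")
    case True
    have "sin (pi/6) \<le> sin t"
      using True t assms by (intro sin_monotone_2pi_le) auto
    then show ?thesis by (simp add: sin_30)
  next
    case False
    have "sin (pi/6) \<le> sin (pi - t)"
      using False t assms by (intro sin_monotone_2pi_le) auto
    then show ?thesis by (simp add: sin_30)
  qed
  then have "ln (2 * sin t) \<ge> 0" by (intro ln_ge_zero) auto
  then show "\<exists>d. (log_sine_integral has_real_derivative d) (at t) \<and> 0 \<le> d"
    using log_sine_integral_deriv[OF t'] by blast
qed

lemma log_sine_integral_nonpos:
  assumes "0 < x" "x \<le> pi / 6"
  shows "log_sine_integral x \<le> 0"
proof (rule tendsto_lowerbound[OF log_sine_integral_tendsto_0])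
  show "\<forall>\<^sub>F y in at_right 0. log_sine_integral x \<le> log_sine_integral y"
    unfolding eventually_at_right_field
  proof (intro exI[of _ x] conjI assms allI impI)
    fix y assume y: "y > 0" "y < x"
    show "log_sine_integral x \<le> log_sine_integral y"
    proof (rule DERIV_nonpos_imp_nonincreasing[where f = log_sine_integral])
      fix t assume t: "y \<le> t" "t \<le> x"
      have t': "0 < t" "t < pi" using t y assms pi_gt_zero by linarith+
      have "sin t \<le> sin (pi/6)"
        using t t' assms by (intro sin_monotone_2pi_le) auto
      then have "sin t \<le> 1/2" by (simp add: sin_30)
      moreover have "sin t > 0" using t' by (rule sin_gt_zero)
      ultimately have "ln (2 * sin t) \<le> 0" by (subst ln_le_zero_iff) auto
      then show "\<exists>d. (log_sine_integral has_real_derivative d) (at t) \<and> d \<le> 0"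
        using log_sine_integral_deriv[OF t'] by blast
    qed (use y in auto)
  qed
qed auto

lemma log_sine_integral_peak_near:
  assumes "2 * pi / 3 \<le> x" "x < pi"
  shows "log_sine_integral x \<le> log_sine_integral (5 * pi / 6) - (x - 5 * pi / 6)\<^sup>2 / 4"
proof -
  define x0 where "x0 = 5 * pi / 6"
  define G where "G = (\<lambda>x. log_sine_integral x + (x - x0)\<^sup>2 / 4)"
  define G' where "G' = (\<lambda>x. ln (2 * sin x) + (x - x0) / 2)"
  have dG: "(G has_real_derivative G' t) (at t)" if "0 < t" "t < pi" for t
    unfolding G_def G'_def using that
    by (auto intro!: derivative_eq_intros log_sine_integral_deriv)
  have dG': "(G' has_real_derivative cot t + 1 / 2) (at t)" if "0 < t" "t < pi" for t
    unfolding G'_def by (rule DERIV_add[OF log_sine_deriv[OF that]]) (auto intro!: derivative_eq_intros)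
  have cot: "cot t + 1 / 2 \<le> 0" if "2 * pi / 3 \<le> t" "t < pi" for t
  proof -
    have "cot t \<le> cot (2 * pi / 3)"
      using that by (intro cot_antimono) auto
    also have "cot (2 * pi / 3) = - 1 / sqrt 3"
      by (simp add: cot_def cos_120 sin_120)
    also have "\<dots> \<le> - 1 / 2"
      using real_sqrt_le_mono[of 3 4] by (simp add: field_simps)
    finally show ?thesis by simp
  qed
  have G'0: "G' x0 = 0"
    by (simp add: G'_def x0_def sin_5pi6)
  have anti: "G' t \<le> G' s" if "2 * pi / 3 \<le> s" "s \<le> t" "t < pi" for s t
  proof (rule DERIV_nonpos_imp_nonincreasing[OF that(2)])
    fix u assume u: "s \<le> u" "u \<le> t"
    have u': "0 < u" "u < pi" "2 * pi / 3 \<le> u" using u that pi_gt_zero by linarith+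
    show "\<exists>d. (G' has_real_derivative d) (at u) \<and> d \<le> 0"
      using dG'[OF u'(1,2)] cot[OF u'(3,2)] by blast
  qed
  have "G x \<le> G x0"
  proof (cases "x \<le> x0")
    case True
    show ?thesis
    proof (rule DERIV_nonneg_imp_nondecreasing[OF True])
      fix u assume u: "x \<le> u" "u \<le> x0"
      have u': "0 < u" "u < pi" using u assms pi_gt_zero unfolding x0_def by linarith+
      have "0 \<le> G' u"
        using anti[of u x0] u assms G'0 by (simp add: x0_def)
      then show "\<exists>d. (G has_real_derivative d) (at u) \<and> 0 \<le> d"
        using dG[OF u'] by blast
    qed
  next
    case False
    show ?thesis
    proof (rule DERIV_nonpos_imp_nonincreasing[of x0 x])
      fix u assume u: "x0 \<le> u" "u \<le> x"
      have u': "0 < u" "u < pi" using u assms pi_gt_zero unfolding x0_def by linarith+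
      have "G' u \<le> 0"
        using anti[of x0 u] u assms G'0 by (simp add: x0_def)
      then show "\<exists>d. (G has_real_derivative d) (at u) \<and> d \<le> 0"
        using dG[OF u'] by blast
    qed (use False in auto)
  qed
  then show ?thesis by (simp add: G_def x0_def)
qed

text \<open>
  A quadratic bound at the maximum. The derivative \<open>ln (2 sin t)\<close> vanishes at \<open>5\<pi>/6\<close> and its slope \<open>cot\<close> is at
  most \<open>-1/2\<close> to the right of \<open>2\<pi>/3\<close>, which settles that range; to the left the function does not exceed its
  value at \<open>2\<pi>/3\<close>. The constant is small enough for this since \<open>(5\<pi>/6)\<^sup>2/100 = (\<pi>/6)\<^sup>2/4\<close>.
\<close>

lemma log_sine_integral_peak:
  assumes "0 \<le> x" "x < pi"
  shows "log_sine_integral x \<le> log_sine_integral (5 * pi / 6) - (x - 5 * pi / 6)\<^sup>2 / 100"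
proof (cases "2 * pi / 3 \<le> x")
  case True
  have "(x - 5 * pi / 6)\<^sup>2 / 100 \<le> (x - 5 * pi / 6)\<^sup>2 / 4" by simp
  then show ?thesis using log_sine_integral_peak_near[OF True assms(2)] by linarith
next
  case False
  have 1: "log_sine_integral (2*pi/3) \<le> log_sine_integral (5*pi/6) - (pi/6)\<^sup>2 / 4"
    using log_sine_integral_peak_near[of "2*pi/3"] by (simp add: power2_eq_square field_simps)
  have "(5 * pi / 6 - x)\<^sup>2 \<le> (5 * pi / 6)\<^sup>2"
    using False assms pi_gt_zero by (intro power_mono) auto
  then have 2: "(x - 5 * pi / 6)\<^sup>2 / 100 \<le> (pi/6)\<^sup>2 / 4"
    by (simp add: power2_eq_square field_simps)
  have 3: "0 \<le> log_sine_integral (2*pi/3)"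
    using log_sine_integral_mono_section[of "pi/2" "2*pi/3"] log_sine_integral_half_pi pi_gt_zero
    by simp
  have "log_sine_integral x \<le> log_sine_integral (2*pi/3)"
  proof (cases "x \<le> pi / 6")
    case True
    then show ?thesis using 3 log_sine_integral_nonpos[of x] assms by (cases "x = 0") auto
  next
    case False': False
    then show ?thesis using False by (intro log_sine_integral_mono_section) auto
  qed
  then show ?thesis using 1 2 by linarith
qed

lemma log_sine_integral_ge:
  assumes "0 < x" "x < pi"
  shows "- log_sine_integral (5 * pi / 6) \<le> log_sine_integral x"
proof -
  have "log_sine_integral (pi - x) \<le> log_sine_integral (5 * pi / 6)"
  proof -
    have "0 \<le> (pi - x - 5 * pi / 6)\<^sup>2 / 100" by simp
    then show ?thesis using log_sine_integral_peak[of "pi - x"] assms by linarith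
  qed
  then show ?thesis
    using log_sine_integral_reflect[OF assms] log_sine_integral_half_pi by simp
qed

section \<open>Products of sines at half-integers\<close>

lemma log_sinc_deriv:
  assumes "0 < x" "x < pi"
  shows "(log_sinc has_real_derivative cot_defect x) (at x)"
proof -
  have "((\<lambda>x. ln (sin x / x)) has_real_derivative cot_defect x) (at x)"
    using sin_gt_zero[OF assms] assms
    by (auto intro!: derivative_eq_intros simp: cot_defect_def cot_def field_simps power2_eq_square)
  then show ?thesis
    by (rule has_field_derivative_transform_within_open[of _ _ _ "{0<..<pi}"])
       (use assms in \<open>auto simp: log_sinc_def\<close>)
qed

lemma cot_defect_nonpos:
  assumes "0 \<le> x" "x < pi"
  shows "cot_defect x \<le> 0"
proof (cases "x = 0")
  case False
  have "sin 0 - 0 * cos 0 \<le> sin x - x * cos x"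
  proof (rule DERIV_nonneg_imp_nondecreasing[OF assms(1)])
    fix t assume t: "0 \<le> t" "t \<le> x"
    have "((\<lambda>x. sin x - x * cos x) has_real_derivative t * sin t) (at t)"
      by (auto intro!: derivative_eq_intros)
    moreover have "t * sin t \<ge> 0" using t assms by (intro mult_nonneg_nonneg sin_ge_zero) auto
    ultimately show "\<exists>d. ((\<lambda>x. sin x - x * cos x) has_real_derivative d) (at t) \<and> 0 \<le> d"
      by blast
  qed
  then show ?thesis using sin_gt_zero[of x] assms False
    by (simp add: cot_defect_def cot_def field_simps)
qed (simp add: cot_defect_def cot_def)

lemma cot_defect_antimono:
  assumes "0 \<le> x" "x \<le> y" "y < pi"
  shows "cot_defect y \<le> cot_defect x"
proof (cases "x = 0")
  case True
  then show ?thesis using cot_defect_nonpos[of y] assms by (simp add: cot_defect_def cot_def)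
next
  case False
  show ?thesis
  proof (rule DERIV_nonpos_imp_nonincreasing[OF assms(2)])
    fix t assume t: "x \<le> t" "t \<le> y"
    then have t': "0 < t" "t < pi" using False assms by auto
    then have "sin t > 0" by (rule sin_gt_zero)
    have "sin t ^ 2 \<le> t ^ 2"
      using sin_x_le_x[of t] t' \<open>sin t > 0\<close> by (intro power_mono) auto
    then have "1 / t ^ 2 - 1 / sin t ^ 2 \<le> 0"
      using t' \<open>sin t > 0\<close> by (simp add: frac_le)
    moreover have "(cot_defect has_real_derivative 1 / t ^ 2 - 1 / sin t ^ 2) (at t)"
      unfolding cot_defect_def[abs_def] using t' \<open>sin t > 0\<close>
      by (auto intro!: derivative_eq_intros DERIV_cot simp: field_simps power2_eq_square)
    ultimately show "\<exists>d. (cot_defect has_real_derivative d) (at t) \<and> d \<le> 0" by blast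
  qed
qed

lemma cot_defect_ge:
  assumes "0 < x" "x < pi"
  shows "- cot_defect x \<le> 1 / x + 1 / (pi - x)"
  using cot_defect_nonpos[of "pi - x"] assms by (simp add: cot_defect_def cot_def)

text \<open>
  The error is controlled by the variation of the second derivative \<open>cot_defect\<close> of the integral. As this
  function is monotone, the bounds for consecutive intervals telescope.
\<close>

lemma midpoint_rule_log_sinc:
  assumes "0 \<le> a" "a < b" "b < pi"
  shows "\<bar>log_sinc_integral b - log_sinc_integral a - (b - a) * log_sinc ((a + b) / 2)\<bar>
    \<le> (b - a)\<^sup>2 / 4 * (cot_defect a - cot_defect b)"
proof -
  define c where "c = (a + b) / 2"
  define w where "w = (b - a) / 2"
  have w: "w > 0" "c - w = a" "c + w = b" using assms by (auto simp: c_def w_def field_simps)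
  \<comment> \<open>The error as a function of the half-width of the interval: its derivative is a second
    difference of \<open>log_sinc\<close>, to which the mean value theorem applies.\<close>
  define \<phi> where "\<phi> = (\<lambda>s. log_sinc_integral (c + s) - log_sinc_integral (c - s) - 2 * s * log_sinc c)"
  define \<phi>' where "\<phi>' = (\<lambda>s. log_sinc (c + s) + log_sinc (c - s) - 2 * log_sinc c)"
  have d: "(\<phi> has_real_derivative \<phi>' s) (at s)" if "0 < s" "s < w" for s
  proof -
    have 1: "((\<lambda>s. log_sinc_integral (c + s)) has_real_derivative log_sinc (c + s) * 1) (at s)"
      by (rule DERIV_chain2[OF log_sinc_integral_deriv])
         (use that w assms in \<open>auto intro!: derivative_eq_intros\<close>)
    have 2: "((\<lambda>s. log_sinc_integral (c - s)) has_real_derivative log_sinc (c - s) * (-1)) (at s)"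
      by (rule DERIV_chain2[OF log_sinc_integral_deriv])
         (use that w assms in \<open>auto intro!: derivative_eq_intros\<close>)
    show ?thesis unfolding \<phi>_def \<phi>'_def by (auto intro!: derivative_eq_intros 1 2)
  qed
  have cont: "continuous_on {0..w} \<phi>"
    unfolding \<phi>_def using w assms
    by (intro continuous_intros continuous_on_compose2[OF log_sinc_integral_continuous[of b]]) auto
  obtain s where s: "0 < s" "s < w" "\<phi> w - \<phi> 0 = (w - 0) * \<phi>' s"
  proof -
    have "\<exists>l z. 0 < z \<and> z < w \<and> (\<phi> has_real_derivative l) (at z) \<and> \<phi> w - \<phi> 0 = (w - 0) * l"
      using d by (intro MVT[OF w(1) cont]) (auto simp: real_differentiable_def)
    then show ?thesis using that d DERIV_unique by blast
  qed
  have mvt: "\<exists>u. x < u \<and> u < y \<and> log_sinc y - log_sinc x = (y - x) * cot_defect u"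
    if "x < y" "a < x" "y < b" for x y
    using that assms by (intro MVT2) (auto intro!: log_sinc_deriv)
  obtain u where u: "c < u" "u < c + s" "log_sinc (c + s) - log_sinc c = s * cot_defect u"
    using mvt[of c "c + s"] s w by auto
  obtain v where v: "c - s < v" "v < c" "log_sinc c - log_sinc (c - s) = s * cot_defect v"
    using mvt[of "c - s" c] s w by auto
  have bounds: "cot_defect b \<le> cot_defect u" "cot_defect u \<le> cot_defect a"
      "cot_defect b \<le> cot_defect v" "cot_defect v \<le> cot_defect a"
    using u v s w assms by (auto intro!: cot_defect_antimono)
  have "\<phi>' s = s * (cot_defect u - cot_defect v)"
    using u(3) v(3) by (simp add: \<phi>'_def algebra_simps)
  then have "\<bar>\<phi>' s\<bar> = s * \<bar>cot_defect u - cot_defect v\<bar>"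
    using s by (simp add: abs_mult)
  also have "\<dots> \<le> w * (cot_defect a - cot_defect b)"
    using bounds s by (intro mult_mono) auto
  finally have "w * \<bar>\<phi>' s\<bar> \<le> w * (w * (cot_defect a - cot_defect b))"
    using w by (intro mult_left_mono) auto
  moreover have "\<phi> w = log_sinc_integral b - log_sinc_integral a - (b - a) * log_sinc ((a + b) / 2)"
    using w by (simp add: \<phi>_def c_def w_def)
  moreover have "\<bar>\<phi> w\<bar> = w * \<bar>\<phi>' s\<bar>"
    using s w by (simp add: \<phi>_def abs_mult)
  moreover have "w * w = (b - a)\<^sup>2 / 4" by (simp add: w_def power2_eq_square)
  ultimately show ?thesis by (metis mult.assoc)
qed

definition half_sine_prod :: "nat \<Rightarrow> nat \<Rightarrow> real" where
  "half_sine_prod N K = (\<Prod>j = 1..K. 2 * sin (pi * (real j - 1 / 2) / (real N + 1 / 2)))"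

text \<open>
  The midpoint error for \<open>\<integral>\<^bsub>0..K\<^esub> ln t dt\<close>.
\<close>

definition half_stirling_defect :: "nat \<Rightarrow> real" where
  "half_stirling_defect K = (\<Sum>j = 1..K. ln (real j - 1 / 2)) - real K * ln (real K) + real K"

lemma half_sine_prod_0 [simp]: "half_sine_prod N 0 = 1"
  by (simp add: half_sine_prod_def)

lemma half_sine_prod_Suc:
  "half_sine_prod N (Suc K) =
     half_sine_prod N K * (2 * sin (pi * (real K + 1 / 2) / (real N + 1 / 2)))"
  by (simp add: half_sine_prod_def add.commute[of "1 / 2"])

lemma angle_less_pi:
  assumes "x < real N + 1 / 2"
  shows "pi * x / (real N + 1 / 2) < pi"
proof -
  have "pi * x < pi * (real N + 1 / 2)" using assms by (intro mult_strict_left_mono) auto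
  then show ?thesis by (simp add: pos_divide_less_eq)
qed

lemma half_angle_sin_pos:
  assumes "0 < x" "x < real N + 1 / 2"
  shows "sin (pi * x / (real N + 1 / 2)) > 0"
  using assms by (intro sin_gt_zero angle_less_pi divide_pos_pos) auto

lemma half_sine_prod_pos: "K \<le> N \<Longrightarrow> half_sine_prod N K > 0"
  unfolding half_sine_prod_def by (intro prod_pos mult_pos_pos half_angle_sin_pos) auto

lemma sum_log_sinc_midpoints:
  fixes N K :: nat and n :: real
  defines "n \<equiv> real N + 1 / 2"
  assumes "K \<le> N"
  shows "\<bar>(\<Sum>j = 1..K. log_sinc (pi * (real j - 1 / 2) / n)) - n / pi * log_sinc_integral (pi * K / n)\<bar>
    \<le> pi / (4 * n) * (- cot_defect (pi * K / n))"
  using assms(2)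
proof (induction K)
  case 0
  then show ?case by (simp add: cot_defect_def cot_def)
next
  case (Suc K)
  have n: "n > 0" by (simp add: n_def)
  define a where "a = pi * K / n"
  define b where "b = pi * Suc K / n"
  have ab: "0 \<le> a" "a < b" "b < pi"
    using Suc.prems n angle_less_pi[of "Suc K" N]
    by (auto simp: a_def b_def n_def intro!: divide_strict_right_mono)
  have ba: "b - a = pi / n" "(a + b) / 2 = pi * (real (Suc K) - 1 / 2) / n"
    using n by (auto simp: a_def b_def field_simps)
  define D where "D = log_sinc_integral b - log_sinc_integral a - pi / n * log_sinc ((a + b) / 2)"
  have "\<bar>n / pi * D\<bar> = n / pi * \<bar>D\<bar>" using n by (simp add: abs_mult)
  also have "\<dots> \<le> n / pi * ((pi / n)\<^sup>2 / 4 * (cot_defect a - cot_defect b))"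
    using midpoint_rule_log_sinc[OF ab] n unfolding ba(1) D_def
    by (intro mult_left_mono) auto
  also have "\<dots> = pi / (4 * n) * (cot_defect a - cot_defect b)"
    using n by (simp add: power2_eq_square field_simps)
  finally have 1: "\<bar>n / pi * D\<bar> \<le> pi / (4 * n) * (cot_defect a - cot_defect b)" .
  have 2: "n / pi * D = n / pi * log_sinc_integral b - n / pi * log_sinc_integral a - log_sinc ((a + b) / 2)"
    using n by (simp add: D_def field_simps)
  have 3: "\<bar>(\<Sum>j = 1..K. log_sinc (pi * (real j - 1 / 2) / n)) - n / pi * log_sinc_integral a\<bar>
      \<le> pi / (4 * n) * (- cot_defect a)"
    using Suc by (simp add: a_def)
  have 4: "(\<Sum>j = 1..Suc K. log_sinc (pi * (real j - 1 / 2) / n)) =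
      (\<Sum>j = 1..K. log_sinc (pi * (real j - 1 / 2) / n)) + log_sinc ((a + b) / 2)"
    by (simp add: ba(2))
  have "(\<Sum>j = 1..Suc K. log_sinc (pi * (real j - 1 / 2) / n)) - n / pi * log_sinc_integral b =
      ((\<Sum>j = 1..K. log_sinc (pi * (real j - 1 / 2) / n)) - n / pi * log_sinc_integral a) - n / pi * D"
    unfolding 2 4 by simp
  also have "\<bar>\<dots>\<bar> \<le> pi / (4 * n) * (- cot_defect a) + pi / (4 * n) * (cot_defect a - cot_defect b)"
    by (rule order_trans[OF abs_triangle_ineq4 add_mono[OF 3 1]])
  also have "\<dots> = pi / (4 * n) * (- cot_defect b)"
    by (subst distrib_left[symmetric]) simp
  finally show ?case unfolding b_def .
qed

text \<open>
  The sum of \<open>ln (2 sin x\<^sub>j)\<close> is split as in \<open>log_sine_integral_eq\<close>: the singular part has the error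
  \<open>half_stirling_defect K\<close>, and the smooth part at most \<open>\<pi>/(4n)\<close> times the size of \<open>cot_defect\<close> at
  \<open>\<pi>K/n\<close>. The bound stays finite up to \<open>K = N\<close>, where that derivative is of order \<open>n\<close>.
\<close>

lemma ln_half_sine_prod:
  fixes N K :: nat and n :: real
  defines "n \<equiv> real N + 1 / 2"
  assumes K: "1 \<le> K" "K \<le> N"
  shows "\<bar>ln (half_sine_prod N K) - n / pi * log_sine_integral (pi * K / n) - half_stirling_defect K\<bar>
    \<le> (1 / K + 1 / (n - K)) / 4"
proof -
  have n: "n > 0" "real K < n" using K by (auto simp: n_def)
  define x where "x = pi * K / n"
  have x: "0 < x" "x < pi"
    using K n angle_less_pi[of K N] by (auto simp: x_def n_def)
  have "ln (half_sine_prod N K) = (\<Sum>j = 1..K. ln (2 * sin (pi * (real j - 1 / 2) / n)))"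
    unfolding half_sine_prod_def n_def
    using K by (intro ln_prod[OF _ less_imp_neq[THEN not_sym]] mult_pos_pos half_angle_sin_pos) auto
  also have "\<dots> = (\<Sum>j = 1..K. ln (2 * pi / n) + ln (real j - 1 / 2) + log_sinc (pi * (real j - 1 / 2) / n))"
  proof (rule sum.cong[OF refl])
    fix j assume j: "j \<in> {1..K}"
    define t where "t = pi * (real j - 1 / 2) / n"
    have t: "t > 0" using j n by (simp add: t_def)
    have s: "sin t > 0" unfolding t_def n_def using j K by (intro half_angle_sin_pos) auto
    have "ln (2 * sin t) = ln (2 * t * (sin t / t))" using t by simp
    also have "\<dots> = ln (2 * t) + ln (sin t / t)" using t s by (subst ln_mult) auto
    also have "2 * t = 2 * pi / n * (real j - 1 / 2)" by (simp add: t_def)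
    also have "ln \<dots> = ln (2 * pi / n) + ln (real j - 1 / 2)"
      using n j by (subst ln_mult) auto
    finally show "ln (2 * sin (pi * (real j - 1 / 2) / n)) =
        ln (2 * pi / n) + ln (real j - 1 / 2) + log_sinc (pi * (real j - 1 / 2) / n)"
      using t by (simp add: log_sinc_def flip: t_def)
  qed
  also have "\<dots> = K * ln (2 * pi / n) + (\<Sum>j = 1..K. ln (real j - 1 / 2))
      + (\<Sum>j = 1..K. log_sinc (pi * (real j - 1 / 2) / n))"
    by (simp add: sum.distrib)
  finally have lnP: "ln (half_sine_prod N K) = \<dots>" .
  have "n / pi * log_sine_integral x = n / pi * log_sinc_integral x + K * ln (2 * x) - K"
    using n unfolding log_sine_integral_eq[OF x] by (simp add: x_def field_simps)
  moreover have "ln (2 * x) = ln (2 * pi / n) + ln K"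
  proof -
    have "2 * x = 2 * pi / n * K" by (simp add: x_def)
    also have "ln \<dots> = ln (2 * pi / n) + ln K" using n K by (intro ln_mult_pos) auto
    finally show ?thesis .
  qed
  ultimately have "ln (half_sine_prod N K) - n / pi * log_sine_integral x - half_stirling_defect K =
      (\<Sum>j = 1..K. log_sinc (pi * (real j - 1 / 2) / n)) - n / pi * log_sinc_integral x"
    unfolding lnP half_stirling_defect_def by (simp add: algebra_simps)
  also have "\<bar>\<dots>\<bar> \<le> pi / (4 * n) * (- cot_defect x)"
    using sum_log_sinc_midpoints[OF K(2)] by (simp add: x_def n_def)
  also have "\<dots> \<le> pi / (4 * n) * (1 / x + 1 / (pi - x))"
    using n x by (intro mult_left_mono cot_defect_ge) auto
  also have "\<dots> = (1 / K + 1 / (n - K)) / 4"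
  proof -
    have "pi - x = pi * (n - K) / n" using n by (simp add: x_def field_simps)
    then show ?thesis using n K by (simp add: x_def field_simps)
  qed
  finally show ?thesis by (simp add: x_def)
qed

text \<open>
  As \<open>\<Prod>\<^bsub>j=1..K\<^esub> (j - 1/2) = (2K)! / (4\<^sup>K K!)\<close>, only the convergence of the error in Stirling's formula is needed:
  its limit cancels between \<open>(2K)!\<close> and \<open>K!\<close>.
\<close>

lemma half_stirling_defect_limit: "half_stirling_defect \<longlonglongrightarrow> ln 2 / 2"
proof -
  define s where "s = (\<lambda>K. ln (fact K) - (real K + 1 / 2) * ln (real K) + real K)"
  have "summable (\<lambda>K. s (Suc K) - s K)"
  proof (rule summable_comparison_test_bigo)
    show "summable (\<lambda>n. norm (1 / real n ^ 2))"
      using inverse_power_summable[of 2] by (simp add: field_simps)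
    have "s (Suc K) - s K = 1 - (real K + 1 / 2) * (ln (real K + 1) - ln (real K))" for K
    proof -
      have "ln (fact (Suc K) :: real) = ln (real K + 1) + ln (fact K)"
        by (simp add: ln_mult add.commute)
      then show ?thesis by (simp add: s_def algebra_simps)
    qed
    moreover have "(\<lambda>K::nat. 1 - (real K + 1 / 2) * (ln (real K + 1) - ln (real K))) \<in> O(\<lambda>n. 1 / real n ^ 2)"
      by real_asymp
    ultimately show "(\<lambda>K. s (Suc K) - s K) \<in> O(\<lambda>n. 1 / real n ^ 2)" by simp
  qed
  then obtain l where "(\<lambda>K. \<Sum>i<K. s (Suc i) - s i) \<longlonglongrightarrow> l"
    by (auto simp: summable_def sums_def)
  then have "(\<lambda>K. s K - s 0) \<longlonglongrightarrow> l" by (simp add: sum_lessThan_telescope)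
  from tendsto_add[OF this tendsto_const[of "s 0"]] have s: "s \<longlonglongrightarrow> l + s 0" by simp
  have "(\<lambda>K. s (2 * K) - s K + ln 2 / 2) \<longlonglongrightarrow> (l + s 0) - (l + s 0) + ln 2 / 2"
    by (intro tendsto_intros s filterlim_compose[OF s]) real_asymp
  moreover have "\<forall>\<^sub>F K in at_top. s (2 * K) - s K + ln 2 / 2 = half_stirling_defect K"
    using eventually_gt_at_top[of 0]
  proof eventually_elim
    case (elim K)
    have "(\<Sum>j = 1..K. ln (real j - 1 / 2)) = ln (fact (2 * K)) - K * ln 4 - ln (fact K)"
    proof (induction K)
      case (Suc K)
      have "(fact (2 * Suc K) :: real) = (2 * real K + 2) * (2 * real K + 1) * fact (2 * K)"
        by (simp add: algebra_simps)
      also have "(2 * real K + 2) * (2 * real K + 1) = 4 * (real K + 1) * (real K + 1 / 2)"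
        by (simp add: algebra_simps)
      finally have "ln (fact (2 * Suc K) :: real) =
          ln 4 + ln (real K + 1) + ln (real K + 1 / 2) + ln (fact (2 * K))"
        by (simp add: ln_mult_pos del: distrib_left_numeral fact_Suc mult_Suc_right)
      moreover have "ln (fact (Suc K) :: real) = ln (real K + 1) + ln (fact K)"
        by (simp add: ln_mult add.commute)
      ultimately show ?case using Suc by (simp add: algebra_simps)
    qed simp
    moreover have "ln (4::real) = 2 * ln 2" using ln_realpow[of 2 2] by simp
    ultimately show ?case using elim
      by (simp add: s_def half_stirling_defect_def ln_mult algebra_simps add_divide_distrib)
  qed
  ultimately show ?thesis using tendsto_cong by force
qed

lemma half_sine_prod_uniform:
  obtains C where "C \<ge> 0" "\<And>N K. K \<le> N \<Longrightarrow>
    \<bar>ln (half_sine_prod N K) - (real N + 1 / 2) / pi * log_sine_integral (pi * K / (real N + 1 / 2))\<bar> \<le> C"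
proof -
  obtain B where B: "\<And>K. \<bar>half_stirling_defect K\<bar> \<le> B"
    using half_stirling_defect_limit convergent_imp_Bseq[of half_stirling_defect]
    by (auto simp: convergent_def Bseq_def)
  have B0: "B \<ge> 0" using B[of 0] by linarith
  have "\<bar>ln (half_sine_prod N K) - (real N + 1 / 2) / pi * log_sine_integral (pi * K / (real N + 1 / 2))\<bar> \<le> B + 1"
    if "K \<le> N" for N K
  proof (cases "K = 0")
    case True
    then show ?thesis using B0 by simp
  next
    case False
    then have "1 / real K \<le> 1" "1 / (real N + 1 / 2 - real K) \<le> 2"
      using that by (auto simp: field_simps)
    moreover have "\<bar>ln (half_sine_prod N K) - (real N + 1 / 2) / pi * log_sine_integral (pi * K / (real N + 1 / 2))
        - half_stirling_defect K\<bar> \<le> (1 / K + 1 / (real N + 1 / 2 - K)) / 4"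
      using False that by (intro ln_half_sine_prod) auto
    moreover have "\<bar>X - Y\<bar> \<le> B + 1"
      if "\<bar>X - Y - half_stirling_defect K\<bar> \<le> (u + v) / 4" "u \<le> 1" "v \<le> 2" for X Y u v
    proof -
      have "\<bar>X - Y\<bar> \<le> \<bar>X - Y - half_stirling_defect K\<bar> + \<bar>half_stirling_defect K\<bar>"
        using abs_triangle_ineq[of "X - Y - half_stirling_defect K" "half_stirling_defect K"] by simp
      also have "\<dots> \<le> (1 + 2) / 4 + B" using that B[of K] by (intro add_mono) auto
      finally show ?thesis by simp
    qed
    ultimately show ?thesis by blast
  qed
  then show ?thesis using that[of "B + 1"] B0 by auto
qed

lemma cot_5pi6: "cot (5 * pi / 6) = - sqrt 3"
  unfolding cot_def sin_5pi6 cos_5pi6 by simp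

text \<open>
  The second-order Taylor coefficient at the maximum, half of \<open>cot (5\<pi>/6) = -\<surd>3\<close>.
\<close>

lemma log_sine_integral_taylor:
  "((\<lambda>s. (log_sine_integral (5 * pi / 6 + s) - log_sine_integral (5 * pi / 6)) / s\<^sup>2)
    \<longlongrightarrow> - sqrt 3 / 2) (at 0)"
proof (rule lhopital[where f' = "\<lambda>s. ln (2 * sin (5 * pi / 6 + s))" and g' = "\<lambda>s. 2 * s"])
  have "isCont (\<lambda>s. log_sine_integral (5 * pi / 6 + s)) 0"
    by (rule isCont_o2[OF _ log_sine_integral_isCont]) auto
  then have "((\<lambda>s. log_sine_integral (5 * pi / 6 + s)) \<longlongrightarrow> log_sine_integral (5 * pi / 6)) (at 0)"
    by (simp add: isCont_def)
  then show "((\<lambda>s. log_sine_integral (5 * pi / 6 + s) - log_sine_integral (5 * pi / 6)) \<longlongrightarrow> 0) (at 0)"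
    by (simp add: LIM_zero)
  show "((\<lambda>s::real. s\<^sup>2) \<longlongrightarrow> 0) (at 0)"
    by (auto intro!: tendsto_eq_intros)
  show "\<forall>\<^sub>F s::real in at 0. s\<^sup>2 \<noteq> 0" "\<forall>\<^sub>F s::real in at 0. 2 * s \<noteq> 0"
    by (auto simp: eventually_at_filter)
  show "\<forall>\<^sub>F s::real in at 0. ((\<lambda>s. s\<^sup>2) has_real_derivative 2 * s) (at s)"
    by (auto intro!: always_eventually derivative_eq_intros)
  have "\<forall>\<^sub>F s::real in nhds 0. s \<in> {- pi / 6<..<pi / 6}"
    by (rule eventually_nhds_in_open) auto
  then have "\<forall>\<^sub>F s::real in at 0. s \<in> {- pi / 6<..<pi / 6}"
    by (auto simp: eventually_at_filter elim: eventually_mono)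
  then show "\<forall>\<^sub>F s in at 0. ((\<lambda>s. log_sine_integral (5 * pi / 6 + s) - log_sine_integral (5 * pi / 6))
      has_real_derivative ln (2 * sin (5 * pi / 6 + s))) (at s)"
  proof eventually_elim
    case (elim s)
    have "((\<lambda>s. log_sine_integral (5 * pi / 6 + s)) has_real_derivative
        ln (2 * sin (5 * pi / 6 + s)) * 1) (at s)"
      by (rule DERIV_chain2[OF log_sine_integral_deriv])
         (use elim pi_gt_zero in \<open>auto intro!: derivative_eq_intros\<close>)
    then show ?case by (auto intro!: derivative_eq_intros)
  qed
  have "((\<lambda>s. ln (2 * sin (5 * pi / 6 + s))) has_real_derivative cot (5 * pi / 6 + 0) * 1) (at 0)"
    by (rule DERIV_chain2[OF log_sine_deriv]) (auto intro!: derivative_eq_intros)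
  then have "((\<lambda>s. ln (2 * sin (5 * pi / 6 + s)) / s) \<longlongrightarrow> cot (5 * pi / 6)) (at 0)"
    by (simp add: DERIV_def sin_5pi6)
  from tendsto_divide[OF this tendsto_const[of 2]]
  show "((\<lambda>s. ln (2 * sin (5 * pi / 6 + s)) / (2 * s)) \<longlongrightarrow> - sqrt 3 / 2) (at 0)"
    by (simp only: cot_5pi6 divide_divide_eq_left mult.commute[of _ 2])
qed

text \<open>
  By the midpoint rule \<open>ln P(K)\<close> is \<open>(n/\<pi>) F(\<pi>K/n) + (ln 2)/2 + o(1)\<close>. Since \<open>\<pi>K/n = 5\<pi>/6 + \<pi>y/\<surd>n\<close>, the
  Taylor expansion of \<open>F\<close> at its maximum turns the first term into
  \<open>n F(5\<pi>/6)/\<pi> - (\<surd>3 \<pi>/2) y\<^sup>2\<close> up to \<open>o(1)\<close>.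
\<close>

lemma half_sine_prod_local_limit:
  fixes K :: "nat \<Rightarrow> nat" and n :: "nat \<Rightarrow> real"
  defines "n \<equiv> (\<lambda>N. real N + 1 / 2)"
  assumes K: "(\<lambda>N. (real (K N) - 5 * n N / 6) / sqrt (n N)) \<longlonglongrightarrow> y"
  shows "(\<lambda>N. half_sine_prod N (K N) / exp (n N * log_sine_integral (5 * pi / 6) / pi))
    \<longlonglongrightarrow> sqrt 2 * exp (- (sqrt 3 * pi / 2) * y\<^sup>2)"
proof -
  have n: "n N > 0" for N by (simp add: n_def)
  have n_top: "filterlim n at_top sequentially" unfolding n_def by real_asymp
  have sqrt_n: "(\<lambda>N. 1 / sqrt (n N)) \<longlonglongrightarrow> 0" unfolding n_def by real_asymp
  define Y where "Y = (\<lambda>N. (real (K N) - 5 * n N / 6) / sqrt (n N))"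
  define s where "s = (\<lambda>N. pi * (Y N * (1 / sqrt (n N))))"
  have K_eq: "real (K N) = 5 * n N / 6 + Y N * sqrt (n N)" for N
    using n[of N] by (simp add: Y_def)
  have s_eq: "pi * K N / n N = 5 * pi / 6 + s N" for N
    using n[of N] unfolding K_eq s_def
    by (simp add: field_simps)
  have s0: "s \<longlonglongrightarrow> 0"
  proof -
    have "s \<longlonglongrightarrow> pi * (y * 0)"
      unfolding s_def Y_def by (intro tendsto_intros K sqrt_n)
    then show ?thesis by simp
  qed
  have ratio: "(\<lambda>N. K N / n N) \<longlonglongrightarrow> 5 / 6"
  proof -
    have "(\<lambda>N. 5 / 6 + s N / pi) \<longlonglongrightarrow> 5 / 6 + 0 / pi" by (intro tendsto_intros s0) auto
    moreover have "5 / 6 + s N / pi = K N / n N" for N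
      using s_eq[of N] by (simp add: field_simps)
    ultimately show ?thesis by simp
  qed
  have K_top: "filterlim (\<lambda>N. real (K N)) at_top sequentially"
  proof -
    have "filterlim (\<lambda>N. K N / n N * n N) at_top sequentially"
      by (rule filterlim_tendsto_pos_mult_at_top[OF ratio _ n_top]) simp
    then show ?thesis using n by (simp add: less_imp_neq[THEN not_sym])
  qed
  have nK_top: "filterlim (\<lambda>N. n N - real (K N)) at_top sequentially"
  proof -
    have "(\<lambda>N. 1 - K N / n N) \<longlonglongrightarrow> 1 - 5 / 6" by (intro tendsto_intros ratio)
    from filterlim_tendsto_pos_mult_at_top[OF this _ n_top]
    have "filterlim (\<lambda>N. (1 - K N / n N) * n N) at_top sequentially" by simp
    moreover have "(1 - K N / n N) * n N = n N - K N" for N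
      using n[of N] by (simp add: field_simps)
    ultimately show ?thesis by simp
  qed
  have stirling: "(\<lambda>N. half_stirling_defect (K N)) \<longlonglongrightarrow> ln 2 / 2"
    using K_top by (intro filterlim_compose[OF half_stirling_defect_limit])
      (simp add: filterlim_sequentially_iff_filterlim_real)
  define d where "d = (\<lambda>N. ln (half_sine_prod N (K N)) - n N / pi * log_sine_integral (pi * K N / n N)
      - half_stirling_defect (K N))"
  have d0: "d \<longlonglongrightarrow> 0"
  proof (rule Lim_null_comparison)
    have "(\<lambda>N. (1 / real (K N) + 1 / (n N - K N)) / 4) \<longlonglongrightarrow> (0 + 0) / 4"
      by (intro tendsto_intros tendsto_divide_0[OF tendsto_const] filterlim_at_top_imp_at_infinity K_top nK_top) auto
    then show "(\<lambda>N. (1 / real (K N) + 1 / (n N - K N)) / 4) \<longlonglongrightarrow> 0" by simp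
    have "\<forall>\<^sub>F N in sequentially. 1 \<le> real (K N)" "\<forall>\<^sub>F N in sequentially. 1 \<le> n N - real (K N)"
      using K_top nK_top by (simp_all only: filterlim_at_top)
    then show "\<forall>\<^sub>F N in sequentially. norm (d N) \<le> (1 / real (K N) + 1 / (n N - K N)) / 4"
    proof eventually_elim
      case (elim N)
      then have "1 \<le> K N" "K N \<le> N" by (auto simp: n_def)
      then show ?case using ln_half_sine_prod[of "K N" N] by (simp add: d_def n_def)
    qed
  qed
  define q where "q = (\<lambda>s. if s = 0 then - sqrt 3 / 2 else
      (log_sine_integral (5 * pi / 6 + s) - log_sine_integral (5 * pi / 6)) / s\<^sup>2)"
  have "isCont q 0"
    unfolding isCont_def
    by (rule Lim_transform_eventually[of _ _ _ _, OF _]) 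
       (use log_sine_integral_taylor in \<open>auto simp: q_def eventually_at_filter\<close>)
  then have q: "(\<lambda>N. q (s N)) \<longlonglongrightarrow> q 0"
    using s0 by (rule isCont_tendsto_compose)
  have q_eq: "log_sine_integral (5 * pi / 6 + t) = log_sine_integral (5 * pi / 6) + t\<^sup>2 * q t" for t
    by (simp add: q_def)
  have ns: "n N / pi * (s N)\<^sup>2 = pi * (Y N)\<^sup>2" for N
    using n[of N] by (simp add: s_def power_mult_distrib power_divide power2_eq_square field_simps)
  have "(\<lambda>N. d N + half_stirling_defect (K N) + pi * (Y N)\<^sup>2 * q (s N))
      \<longlonglongrightarrow> 0 + ln 2 / 2 + pi * y\<^sup>2 * q 0"
    unfolding Y_def by (intro tendsto_intros d0 stirling K q)
  then have "(\<lambda>N. exp (d N + half_stirling_defect (K N) + pi * (Y N)\<^sup>2 * q (s N)))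
      \<longlonglongrightarrow> exp (0 + ln 2 / 2 + pi * y\<^sup>2 * q 0)"
    by (rule tendsto_exp)
  also have "exp (0 + ln 2 / 2 + pi * y\<^sup>2 * q 0) = sqrt 2 * exp (- (sqrt 3 * pi / 2) * y\<^sup>2)"
  proof -
    have "ln (sqrt 2) = ln 2 / (2::real)" by (simp add: ln_sqrt)
    then have "exp (ln 2 / 2) = sqrt (2::real)" by (metis exp_ln real_sqrt_gt_0_iff zero_less_numeral)
    then have "sqrt 2 * exp u = exp (0 + ln 2 / 2 + u)" for u by (simp add: exp_add)
    moreover have "pi * y\<^sup>2 * q 0 = - (sqrt 3 * pi / 2) * y\<^sup>2" by (simp add: q_def)
    ultimately show ?thesis by metis
  qed
  finally have lim: "(\<lambda>N. exp (d N + half_stirling_defect (K N) + pi * (Y N)\<^sup>2 * q (s N))) \<longlonglongrightarrow> \<dots>" .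
  have "\<forall>\<^sub>F N in sequentially. exp (d N + half_stirling_defect (K N) + pi * (Y N)\<^sup>2 * q (s N)) =
      half_sine_prod N (K N) / exp (n N * log_sine_integral (5 * pi / 6) / pi)"
  proof -
    have "\<forall>\<^sub>F N in sequentially. 1 \<le> n N - real (K N)"
      using nK_top by (auto simp: filterlim_at_top)
    then show ?thesis
    proof eventually_elim
      case (elim N)
      then have "half_sine_prod N (K N) > 0" by (intro half_sine_prod_pos) (auto simp: n_def)
      moreover have "d N + half_stirling_defect (K N) + pi * (Y N)\<^sup>2 * q (s N) =
          ln (half_sine_prod N (K N)) - n N * log_sine_integral (5 * pi / 6) / pi"
        unfolding d_def s_eq q_eq ns[symmetric] by (simp add: algebra_simps add_divide_distrib)
      ultimately show ?case by (simp add: exp_diff)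
    qed
  qed
  with lim show ?thesis by (rule Lim_transform_eventually)
qed

text \<open>
  The upper bound is the quadratic bound for \<open>F\<close> at its maximum. The bound for the reciprocal uses that the
  minimum of \<open>F\<close> is minus its maximum, by reflection.
\<close>

lemma half_sine_prod_gaussian_bound:
  obtains C where "C > 0"
    "\<And>N K. K \<le> N \<Longrightarrow> half_sine_prod N K / exp ((real N + 1 / 2) * log_sine_integral (5 * pi / 6) / pi)
      \<le> C * exp (- (pi / 100) * (real K - 5 * (real N + 1 / 2) / 6)\<^sup>2 / (real N + 1 / 2))"
    "\<And>N K. 1 \<le> K \<Longrightarrow> K \<le> N \<Longrightarrow>
      1 / half_sine_prod N K \<le> C * exp ((real N + 1 / 2) * log_sine_integral (5 * pi / 6) / pi)"
proof -
  obtain C where C: "C \<ge> 0" "\<And>N K. K \<le> N \<Longrightarrow>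
    \<bar>ln (half_sine_prod N K) - (real N + 1 / 2) / pi * log_sine_integral (pi * K / (real N + 1 / 2))\<bar> \<le> C"
    using half_sine_prod_uniform by blast
  let ?V = "log_sine_integral (5 * pi / 6)"
  have 1: "half_sine_prod N K / exp ((real N + 1 / 2) * ?V / pi)
      \<le> exp C * exp (- (pi / 100) * (real K - 5 * (real N + 1 / 2) / 6)\<^sup>2 / (real N + 1 / 2))"
    if K: "K \<le> N" for N K
  proof -
    define n where "n = real N + 1 / 2"
    have n: "n > 0" by (simp add: n_def)
    define x where "x = pi * K / n"
    have x: "0 \<le> x" "x < pi" using angle_less_pi[of K N] K n by (auto simp: x_def n_def)
    have "n / pi * log_sine_integral x \<le> n / pi * (?V - (x - 5 * pi / 6)\<^sup>2 / 100)"
      using n by (intro mult_left_mono log_sine_integral_peak x) auto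
    also have "\<dots> = n * ?V / pi - (pi / 100) * (real K - 5 * n / 6)\<^sup>2 / n"
    proof -
      have "x - 5 * pi / 6 = pi / n * (K - 5 * n / 6)" using n by (simp add: x_def field_simps)
      moreover have "n / pi * (v - (pi / n * D)\<^sup>2 / 100) = n * v / pi - (pi / 100) * D\<^sup>2 / n" for v D
        using n by (simp add: power2_eq_square field_simps)
      ultimately show ?thesis by simp
    qed
    finally have "ln (half_sine_prod N K) \<le> C + (n * ?V / pi - (pi / 100) * (real K - 5 * n / 6)\<^sup>2 / n)"
      using C(2)[OF K] unfolding n_def[symmetric] x_def[symmetric] by linarith
    then have "half_sine_prod N K \<le> exp (C + (n * ?V / pi - (pi / 100) * (real K - 5 * n / 6)\<^sup>2 / n))"
      using half_sine_prod_pos[OF K] by (metis exp_le_cancel_iff exp_ln)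
    moreover have "p / exp a \<le> exp C * exp (- b)" if "p \<le> exp (C + (a - b))" for p a b :: real
      using that by (simp add: exp_add exp_diff exp_minus field_simps)
    ultimately show ?thesis unfolding n_def[symmetric] by fastforce
  qed
  have 2: "1 / half_sine_prod N K \<le> exp C * exp ((real N + 1 / 2) * ?V / pi)"
    if K: "1 \<le> K" "K \<le> N" for N K
  proof -
    define n where "n = real N + 1 / 2"
    have n: "n > 0" by (simp add: n_def)
    define x where "x = pi * K / n"
    have x: "0 < x" "x < pi" using angle_less_pi[of K N] K n by (auto simp: x_def n_def)
    have "n / pi * - ?V \<le> n / pi * log_sine_integral x"
      using n by (intro mult_left_mono log_sine_integral_ge x) auto
    then have "- ln (half_sine_prod N K) \<le> C + n * ?V / pi"
      using C(2)[OF K(2)] unfolding n_def[symmetric] x_def[symmetric] by simp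
    then have "exp (- ln (half_sine_prod N K)) \<le> exp C * exp (n * ?V / pi)"
      by (simp flip: exp_add)
    then show ?thesis
      using half_sine_prod_pos[OF K(2)] unfolding n_def[symmetric]
      by (simp add: exp_minus inverse_eq_divide)
  qed
  show ?thesis by (rule that[of "exp C"]) (use 1 2 in auto)
qed

section \<open>Riemann sums dominated by a Gaussian\<close>

lemma has_bochner_integral_half_gaussian:
  fixes a :: real
  assumes "a > 0"
  shows "has_bochner_integral lborel (\<lambda>x. indicator {0..} x * exp (- a * x\<^sup>2)) (sqrt (pi / a) / 2)"
proof -
  have "has_bochner_integral lborel (\<lambda>x. indicator {0..} (0 + sqrt a * x) *\<^sub>R exp (- (0 + sqrt a * x)\<^sup>2))
      ((sqrt pi / 2) /\<^sub>R \<bar>sqrt a\<bar>)"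
    using gaussian_moment_0 assms by (subst lborel_has_bochner_integral_real_affine_iff[symmetric]) auto
  moreover have "indicator {0..} (0 + sqrt a * x) *\<^sub>R exp (- (0 + sqrt a * x)\<^sup>2) =
      indicator {0..} x * exp (- a * x\<^sup>2)" for x
    using assms by (simp add: indicator_def power_mult_distrib zero_le_mult_iff)
  moreover have "(sqrt pi / 2) /\<^sub>R \<bar>sqrt a\<bar> = sqrt (pi / a) / 2"
    using assms by (simp add: real_sqrt_divide field_simps)
  ultimately show ?thesis by simp
qed

lemma has_bochner_integral_gaussian:
  fixes a :: real
  assumes "a > 0"
  shows "has_bochner_integral lborel (\<lambda>x. exp (- a * x\<^sup>2)) (sqrt (pi / a))"
  using has_bochner_integral_even_function[of "\<lambda>x. exp (- a * x\<^sup>2)" "sqrt (pi / a) / 2"]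
    has_bochner_integral_half_gaussian[OF assms] by simp

lemma integral_floor_step:
  fixes f :: "int \<Rightarrow> real"
  assumes supp: "\<And>t. t \<notin> T \<Longrightarrow> f t = 0" and T: "finite T"
  shows "(\<integral>z. f \<lfloor>z :: real\<rfloor> \<partial>lborel) = (\<Sum>t\<in>T. f t)"
proof -
  have "f \<lfloor>z :: real\<rfloor> = (\<Sum>t\<in>T. f t * indicator {real_of_int t..<real_of_int t + 1} z)" for z
  proof -
    have "f t * indicator {real_of_int t..<real_of_int t + 1} z = (if t = \<lfloor>z\<rfloor> then f t else 0)" for t
      by (auto simp: indicator_def floor_eq_iff) linarith+
    then show ?thesis using supp[of "\<lfloor>z\<rfloor>"] T by (auto simp: sum.delta)
  qed
  then have "(\<integral>z. f \<lfloor>z :: real\<rfloor> \<partial>lborel) =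
      (\<integral>z. (\<Sum>t\<in>T. f t * indicator {real_of_int t..<real_of_int t + 1} z) \<partial>lborel)"
    by (rule Bochner_Integration.integral_cong[OF refl])
  also have "\<dots> = (\<Sum>t\<in>T. f t)"
    by (subst Bochner_Integration.integral_sum) auto
  finally show ?thesis .
qed

text \<open>
  Dominated convergence on \<open>\<real>\<close>: the sum is the integral of the step function \<open>y \<mapsto> f N \<lfloor>y s\<rfloor>\<close>. The point \<open>y = 0\<close> is
  excluded from the hypothesis because the limit may jump there.
\<close>

lemma riemann_sum_gaussian_dominated:
  fixes f :: "nat \<Rightarrow> int \<Rightarrow> real" and s :: "nat \<Rightarrow> real" and b :: "nat \<Rightarrow> nat"
  assumes s: "\<And>N. 1 / 2 \<le> s N"
    and c: "c > 0" and bound: "\<And>N t. \<bar>f N t\<bar> \<le> C * exp (- c * (t / s N)\<^sup>2)"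
    and supp: "\<And>N t. \<bar>t\<bar> > int (b N) \<Longrightarrow> f N t = 0"
    and lim: "\<And>y. y \<noteq> 0 \<Longrightarrow> (\<lambda>N. f N \<lfloor>y * s N\<rfloor>) \<longlonglongrightarrow> g y"
    and g [measurable]: "g \<in> borel_measurable borel"
  shows "(\<lambda>N. (\<Sum>t = - int (b N)..int (b N). f N t) / s N) \<longlonglongrightarrow> (\<integral>y. g y \<partial>lborel)"
proof -
  have C: "C \<ge> 0" using order_trans[OF abs_ge_zero bound[of 0 0]] by simp
  have s_pos: "s N > 0" for N using s[of N] by linarith
  have "(\<Sum>t = - int (b N)..int (b N). f N t) / s N = (\<integral>y. f N \<lfloor>y * s N\<rfloor> \<partial>lborel)" for N
  proof -
    have "(\<Sum>t = - int (b N)..int (b N). f N t) = (\<integral>z. f N \<lfloor>z :: real\<rfloor> \<partial>lborel)"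
      by (rule integral_floor_step[symmetric]) (use supp in auto)
    also have "\<dots> = \<bar>s N\<bar> *\<^sub>R (\<integral>y. f N \<lfloor>0 + s N * y\<rfloor> \<partial>lborel)"
      using s_pos[of N] by (intro lborel_integral_real_affine) auto
    finally show ?thesis using s_pos[of N] by (simp add: mult.commute)
  qed
  moreover have "(\<lambda>N. \<integral>y. f N \<lfloor>y * s N\<rfloor> \<partial>lborel) \<longlonglongrightarrow> (\<integral>y. g y \<partial>lborel)"
  proof (rule integral_dominated_convergence[where w = "\<lambda>y. C * exp (4 * c) * exp (- (c / 2) * y\<^sup>2)"])
    show "g \<in> borel_measurable lborel" by simp
    show "(\<lambda>y. f N \<lfloor>y * s N\<rfloor>) \<in> borel_measurable lborel" for N
      by measurable
    show "integrable lborel (\<lambda>y. C * exp (4 * c) * exp (- (c / 2) * y\<^sup>2))"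
      using has_bochner_integral_gaussian[of "c / 2"] c by (auto simp: has_bochner_integral_iff)
    show "AE y in lborel. (\<lambda>N. f N \<lfloor>y * s N\<rfloor>) \<longlonglongrightarrow> g y"
      using AE_lborel_singleton[of "0::real"] by eventually_elim (rule lim)
    show "AE y in lborel. norm (f N \<lfloor>y * s N\<rfloor>) \<le> C * exp (4 * c) * exp (- (c / 2) * y\<^sup>2)" for N
    proof (rule AE_I2)
      fix y :: real
      \<comment> \<open>The rounding error \<open>r\<close> is at most \<open>1 / s N \<le> 2\<close>, so \<open>(y - r)\<^sup>2 \<ge> y\<^sup>2/2 - 4\<close>.\<close>
      define r where "r = y - \<lfloor>y * s N\<rfloor> / s N"
      have "r * s N = y * s N - \<lfloor>y * s N\<rfloor>" using s_pos[of N] by (simp add: r_def field_simps)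
      then have "0 \<le> r * s N" "r * s N \<le> 1" by linarith+
      moreover have "r * s N \<le> 2 * s N" using calculation s[of N] by linarith
      ultimately have "0 \<le> r" "r \<le> 2" using s_pos[of N] by (auto simp: zero_le_mult_iff)
      then have "r\<^sup>2 \<le> 2\<^sup>2" by (intro power_mono) auto
      moreover have "0 \<le> (y - 2 * r)\<^sup>2" by simp
      ultimately have "y\<^sup>2 / 2 - 4 \<le> (y - r)\<^sup>2"
        by (simp add: power2_diff power_mult_distrib)
      then have "c * (y\<^sup>2 / 2 - 4) \<le> c * (\<lfloor>y * s N\<rfloor> / s N)\<^sup>2"
        using c by (simp add: r_def)
      then have "exp (- c * (\<lfloor>y * s N\<rfloor> / s N)\<^sup>2) \<le> exp (4 * c + - (c / 2) * y\<^sup>2)"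
        by (simp add: algebra_simps)
      then have "C * exp (- c * (\<lfloor>y * s N\<rfloor> / s N)\<^sup>2) \<le> C * (exp (4 * c) * exp (- (c / 2) * y\<^sup>2))"
        using C by (intro mult_left_mono) (simp_all flip: exp_add)
      then show "norm (f N \<lfloor>y * s N\<rfloor>) \<le> C * exp (4 * c) * exp (- (c / 2) * y\<^sup>2)"
        using bound[of N "\<lfloor>y * s N\<rfloor>"] by (simp add: mult.assoc)
    qed
  qed
  ultimately show ?thesis by simp
qed

section \<open>The colored Jones polynomial through products of sines\<close>

text \<open>
  With the sign of the last term taken as positive, a partial sum lies between \<open>0\<close> and its last term
  while the sequence increases, and between its last term minus \<open>B\<close> and \<open>B\<close> once it decreases.
\<close>

lemma abs_alternating_sum_unimodal_le:
  fixes b :: "nat \<Rightarrow> real"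
  assumes B: "0 \<le> B" and bound: "\<And>k. k < K \<Longrightarrow> 0 \<le> b k \<and> b k \<le> B"
    and unimodal: "\<And>k. Suc (Suc k) < K \<Longrightarrow> b (Suc k) \<le> b k \<Longrightarrow> b (Suc (Suc k)) \<le> b (Suc k)"
  shows "\<bar>\<Sum>k<K. (- 1) ^ k * b k\<bar> \<le> B"
proof (cases K)
  case 0
  then show ?thesis using B by simp
next
  case (Suc J)
  define \<sigma> where "\<sigma> = (\<lambda>j. (- 1) ^ j * (\<Sum>k\<le>j. (- 1) ^ k * b k))"
  have step: "\<sigma> (Suc j) = b (Suc j) - \<sigma> j" for j
    by (simp add: \<sigma>_def algebra_simps flip: power_add mult.assoc)
  have "b j - B \<le> \<sigma> j \<and> \<sigma> j \<le> B \<and> (0 \<le> \<sigma> j \<and> \<sigma> j \<le> b j \<or> (Suc j < K \<longrightarrow> b (Suc j) \<le> b j))"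
    if "j < K" for j
    using that
  proof (induction j)
    case 0
    then show ?case using bound[of 0] by (simp add: \<sigma>_def)
  next
    case (Suc j)
    note IH = Suc.IH[OF Suc_lessD[OF Suc.prems]]
    show ?case
    proof (cases "b (Suc j) \<le> b j")
      case True
      then show ?thesis using IH Suc.prems unimodal[of j] unfolding step by auto
    next
      case False
      then show ?thesis using IH Suc.prems bound[of "Suc j"] unfolding step by auto
    qed
  qed
  from this[of J] have "- B \<le> \<sigma> J" "\<sigma> J \<le> B"
    using bound[of J] Suc by auto
  then have "\<bar>\<sigma> J\<bar> \<le> B" by (simp add: abs_le_iff)
  moreover have "\<bar>\<sigma> J\<bar> = \<bar>\<Sum>k<K. (- 1) ^ k * b k\<bar>"
    using Suc by (simp add: \<sigma>_def abs_mult power_abs lessThan_Suc_atMost)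
  ultimately show ?thesis by simp
qed

lemma qpow_diff:
  "qpow (jones_root N) x - qpow (jones_root N) (- x) =
     2 * \<i> * of_real (sin (2 * pi * x / (real N + 1 / 2)))"
proof -
  have "qpow (jones_root N) y = cis (2 * pi * y / (real N + 1 / 2))" for y
    unfolding qpow_def jones_root_def cis_conv_exp by (simp add: mult_ac)
  then show ?thesis
    by (simp add: complex_eq_iff)
qed

text \<open>
  The \<open>k\<close>-th summand of the colored Jones polynomial of color \<open>N - m\<close>, with the sines reflected at \<open>\<pi>\<close>.
\<close>

definition jones_term :: "nat \<Rightarrow> nat \<Rightarrow> nat \<Rightarrow> real" where
  "jones_term N m k = (\<Prod>l = 1..k.
     4 * sin (pi * (real l + real m + 1 / 2) / (real N + 1 / 2))
       * sin (pi * (real l - real m - 1 / 2) / (real N + 1 / 2)))"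

lemma sin_angle_reflect:
  "sin (pi * (real N + 1 / 2 - x) / (real N + 1 / 2)) = sin (pi * x / (real N + 1 / 2))"
proof -
  have "pi * (real N + 1 / 2 - x) / (real N + 1 / 2) = pi - pi * x / (real N + 1 / 2)"
    by (simp add: field_simps)
  then show ?thesis by (simp only: sin_pi_minus)
qed

lemma colored_jones_fig8_eq:
  assumes "m < N"
  shows "colored_jones_fig8 (N - m) (jones_root N) = of_real (\<Sum>k<N - m. jones_term N m k)"
proof -
  define M where "M = N - m"
  have M: "real M = real N - real m" "M > 0" using assms by (auto simp: M_def)
  let ?n = "real N + 1 / 2"
  have factor: "(qpow (jones_root N) ((real M - real l) / 2) - qpow (jones_root N) (- ((real M - real l) / 2))) *
     (qpow (jones_root N) ((real M + real l) / 2) - qpow (jones_root N) (- ((real M + real l) / 2))) =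
     of_real (4 * sin (pi * (real l + real m + 1 / 2) / ?n) * sin (pi * (real l - real m - 1 / 2) / ?n))" for l
  proof -
    have 1: "2 * pi * ((real M - real l) / 2) / ?n = pi * (?n - (real l + real m + 1 / 2)) / ?n"
      by (simp add: M)
    have 2: "2 * pi * ((real M + real l) / 2) / ?n = pi * (?n - (- (real l - real m - 1 / 2))) / ?n"
      by (simp add: M)
    have 3: "sin (pi * (- x) / ?n) = - sin (pi * x / ?n)" for x by simp
    show ?thesis
      unfolding qpow_diff 1 2 sin_angle_reflect 3 by (simp add: complex_eq_iff)
  qed
  have "{..<M} = insert 0 {1..M - 1}" using M(2) by auto
  then have "(\<Sum>k<M. jones_term N m k) = 1 + (\<Sum>k = 1..M - 1. jones_term N m k)"
    by (simp add: jones_term_def)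
  then show ?thesis
    unfolding M_def[symmetric] colored_jones_fig8_def factor
    by (simp add: jones_term_def)
qed

text \<open>
  The starting value is \<open>2 sin a = P(m + 1) / P(m)\<close>. In every factor the first sine extends the numerator,
  and the second one, negative for \<open>l \<le> m\<close>, cancels the top factor of the denominator.
\<close>

lemma jones_term_le:
  assumes "m \<le> N" "k \<le> m"
  shows "2 * sin (pi * (real m + 1 / 2) / (real N + 1 / 2)) * jones_term N m k =
    (- 1) ^ k * (half_sine_prod N (m + k + 1) / half_sine_prod N (m - k))"
  using assms(2)
proof (induction k)
  case 0
  then show ?case
    using half_sine_prod_pos[of m N] assms(1) half_sine_prod_Suc[of N m] by (simp add: jones_term_def)
next
  case (Suc k)
  let ?n = "real N + 1 / 2"
  let ?s = "2 * sin (pi * (real (m - Suc k) + 1 / 2) / ?n)"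
  have "m - k = Suc (m - Suc k)" using Suc.prems by simp
  then have 1: "half_sine_prod N (m - k) = half_sine_prod N (m - Suc k) * ?s"
    by (metis half_sine_prod_Suc)
  have pos: "half_sine_prod N (m - Suc k) > 0" "half_sine_prod N (m - k) > 0"
    using assms(1) by (auto intro!: half_sine_prod_pos)
  then have s: "?s \<noteq> 0" using 1 by auto
  have 2: "half_sine_prod N (m + Suc k + 1) =
      half_sine_prod N (m + k + 1) * (2 * sin (pi * (real (Suc k) + real m + 1 / 2) / ?n))"
    using half_sine_prod_Suc[of N "m + k + 1"] by (simp add: add_ac)
  have "real (Suc k) - real m - 1 / 2 = - (real (m - Suc k) + 1 / 2)"
    using Suc.prems by (simp add: of_nat_diff)
  then have "pi * (real (Suc k) - real m - 1 / 2) / ?n = - (pi * (real (m - Suc k) + 1 / 2) / ?n)"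
    by (simp only: mult_minus_right minus_divide_left)
  then have 3: "sin (pi * (real (Suc k) - real m - 1 / 2) / ?n) = - (?s / 2)"
    by (simp only: sin_minus)
  have 4: "jones_term N m (Suc k) = jones_term N m k * (4 * sin (pi * (real (Suc k) + real m + 1 / 2) / ?n)
       * sin (pi * (real (Suc k) - real m - 1 / 2) / ?n))"
    by (simp add: jones_term_def)
  have IH: "2 * sin (pi * (real m + 1 / 2) / ?n) * jones_term N m k =
    (- 1) ^ k * (half_sine_prod N (m + k + 1) / half_sine_prod N (m - k))"
    using Suc by simp
  have "2 * sin (pi * (real m + 1 / 2) / ?n) * jones_term N m (Suc k) =
      (- 1) ^ k * (half_sine_prod N (m + k + 1) / half_sine_prod N (m - k)) *
      (4 * sin (pi * (real (Suc k) + real m + 1 / 2) / ?n) * (- (?s / 2)))"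
    unfolding 4 3 IH[symmetric] by (simp only: mult.assoc)
  also have "\<dots> = (- 1) ^ Suc k * (half_sine_prod N (m + Suc k + 1) / half_sine_prod N (m - Suc k))"
    unfolding 1 2 using s pos by simp
  finally show ?case .
qed

text \<open>
  After \<open>m\<close> factors the denominator \<open>P(m - k)\<close> is used up, and every further factor is positive
  and extends \<open>P(k - m)\<close>.
\<close>

lemma jones_term_ge:
  assumes "m \<le> N" "m \<le> k"
  shows "2 * sin (pi * (real m + 1 / 2) / (real N + 1 / 2)) * jones_term N m k =
    (- 1) ^ m * (half_sine_prod N (k - m) * half_sine_prod N (k + m + 1))"
  using assms(2)
proof (induction k rule: dec_induct)
  case base
  then show ?case using jones_term_le[OF assms(1), of m] by simp
next
  case (step k)
  let ?n = "real N + 1 / 2"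
  have 1: "half_sine_prod N (Suc k - m) =
      half_sine_prod N (k - m) * (2 * sin (pi * (real (Suc k) - real m - 1 / 2) / ?n))"
  proof -
    have "real (k - m) + 1 / 2 = real (Suc k) - real m - 1 / 2" "Suc k - m = Suc (k - m)"
      using step.hyps by (simp_all add: of_nat_diff)
    then show ?thesis by (simp only: half_sine_prod_Suc)
  qed
  have 2: "half_sine_prod N (Suc k + m + 1) =
      half_sine_prod N (k + m + 1) * (2 * sin (pi * (real (Suc k) + real m + 1 / 2) / ?n))"
    using half_sine_prod_Suc[of N "k + m + 1"] by (simp add: add_ac)
  have 4: "jones_term N m (Suc k) = jones_term N m k * (4 * sin (pi * (real (Suc k) + real m + 1 / 2) / ?n)
       * sin (pi * (real (Suc k) - real m - 1 / 2) / ?n))"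
    by (simp add: jones_term_def)
  have "2 * sin (pi * (real m + 1 / 2) / ?n) * jones_term N m (Suc k) =
      (- 1) ^ m * (half_sine_prod N (k - m) * half_sine_prod N (k + m + 1)) *
      (4 * sin (pi * (real (Suc k) + real m + 1 / 2) / ?n)
       * sin (pi * (real (Suc k) - real m - 1 / 2) / ?n))"
    unfolding 4 step.IH[symmetric] by (simp only: mult.assoc)
  then show ?case unfolding 1 2 by simp
qed

definition jones_head :: "nat \<Rightarrow> nat \<Rightarrow> real" where
  "jones_head N m = (\<Sum>k<min m (N - m).
     (- 1) ^ k * (half_sine_prod N (m + k + 1) / half_sine_prod N (m - k)))"

definition jones_bulk :: "nat \<Rightarrow> nat \<Rightarrow> real" where
  "jones_bulk N m = (\<Sum>k = m..<N - m. half_sine_prod N (k - m) * half_sine_prod N (k + m + 1))"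

lemma sum_jones_term:
  assumes "m < N"
  shows "2 * sin (pi * (real m + 1 / 2) / (real N + 1 / 2)) * (\<Sum>k<N - m. jones_term N m k) =
    jones_head N m + (- 1) ^ m * jones_bulk N m"
proof -
  let ?f = "\<lambda>k. 2 * sin (pi * (real m + 1 / 2) / (real N + 1 / 2)) * jones_term N m k"
  have "{..<N - m} = {..<min m (N - m)} \<union> {m..<N - m}" by auto
  then have "(\<Sum>k<N - m. ?f k) = (\<Sum>k<min m (N - m). ?f k) + (\<Sum>k = m..<N - m. ?f k)"
    by (simp add: sum.union_disjoint[symmetric] disjoint_iff)
  also have "(\<Sum>k<min m (N - m). ?f k) = jones_head N m"
    unfolding jones_head_def using assms by (intro sum.cong refl jones_term_le) auto
  also have "(\<Sum>k = m..<N - m. ?f k) = (- 1) ^ m * jones_bulk N m"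
    unfolding jones_bulk_def sum_distrib_left[of "(- 1) ^ m"]
    using assms by (intro sum.cong refl jones_term_ge) auto
  finally show ?thesis by (simp only: sum_distrib_left)
qed

text \<open>
  The factor \<open>sin a / sin (\<pi>/n)\<close> of the unnormalized polynomial combines with \<open>\<eta>\<^sub>r'\<close>, whose square is
  \<open>2 sin\<^sup>2 (\<pi>/n)/n\<close>.
\<close>

lemma jones_square_sum:
  assumes w: "w \<le> N"
  shows "(eta_r (2 * N + 1))\<^sup>2 * (\<Sum>m<w. (cmod (unnormalized_jones_fig8 (N - m) (jones_root N)))\<^sup>2) =
    (\<Sum>m<w. (jones_head N m + (- 1) ^ m * jones_bulk N m)\<^sup>2) / (2 * (real N + 1 / 2))"
proof -
  let ?n = "real N + 1 / 2"
  have eta: "(eta_r (2 * N + 1))\<^sup>2 = 2 * (sin (pi / ?n))\<^sup>2 / ?n"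
  proof -
    have "2 * pi / real (2 * N + 1) = pi / ?n" "(sqrt (real (2 * N + 1)))\<^sup>2 = 2 * ?n"
      by (simp_all add: field_simps)
    moreover have "2\<^sup>2 * S / (2 * n) = 2 * S / n" for S n :: real by simp
    ultimately show ?thesis unfolding eta_r_def by (simp only: power_divide power_mult_distrib)
  qed
  have summand: "(eta_r (2 * N + 1))\<^sup>2 * (cmod (unnormalized_jones_fig8 (N - m) (jones_root N)))\<^sup>2 =
      (jones_head N m + (- 1) ^ m * jones_bulk N m)\<^sup>2 / (2 * ?n)" if m: "m < N" for m
  proof -
    let ?J = "\<Sum>k<N - m. jones_term N m k"
    have s1: "sin (2 * pi * (1 / 2) / ?n) = sin (pi / ?n)" by simp
    have "2 * pi * (real (N - m) / 2) / ?n = pi * (?n - (real m + 1 / 2)) / ?n"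
      using m by (simp add: of_nat_diff)
    then have s2: "sin (2 * pi * (real (N - m) / 2) / ?n) = sin (pi * (real m + 1 / 2) / ?n)"
      by (simp only: sin_angle_reflect)
    have pos: "sin (pi / ?n) > 0" using half_angle_sin_pos[of 1 N] m by simp
    have "cmod (unnormalized_jones_fig8 (N - m) (jones_root N)) =
        \<bar>sin (pi * (real m + 1 / 2) / ?n)\<bar> / \<bar>sin (pi / ?n)\<bar> * \<bar>?J\<bar>"
      unfolding unnormalized_jones_fig8_def colored_jones_fig8_eq[OF m] qpow_diff s1 s2
      by (simp add: norm_mult norm_divide del: of_real_sum)
    then have "(cmod (unnormalized_jones_fig8 (N - m) (jones_root N)))\<^sup>2 =
        (sin (pi * (real m + 1 / 2) / ?n) * ?J)\<^sup>2 / (sin (pi / ?n))\<^sup>2"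
      by (simp add: power_mult_distrib power_divide)
    also have "sin (pi * (real m + 1 / 2) / ?n) * ?J = (jones_head N m + (- 1) ^ m * jones_bulk N m) / 2"
      using sum_jones_term[OF m] by simp
    finally show ?thesis unfolding eta using pos
      by (simp add: power_divide field_simps)
  qed
  show ?thesis
    unfolding sum_distrib_left sum_divide_distrib using w by (intro sum.cong refl summand) auto
qed

text \<open>
  The exponential order \<open>E\<close> of \<open>half_sine_prod\<close> at its maximum, which is attained near \<open>K = 5n/6\<close>.
\<close>

definition peak :: "nat \<Rightarrow> real" where
  "peak N = exp ((real N + 1 / 2) * log_sine_integral (5 * pi / 6) / pi)"

lemma peak_pos: "peak N > 0" by (simp add: peak_def)

text \<open>
  Consecutive terms have the ratio \<open>4 sin (u + v) sin (u - v) = 2 (cos 2v - cos 2u)\<close> with \<open>v = \<pi>(k + 1)/n\<close>. This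
  decreases in \<open>k\<close> because \<open>2v \<le> \<pi>\<close> in the range of summation, so the terms are unimodal and
  their alternating sum is at most the largest of them. The two bounds of \<open>half_sine_prod_gaussian_bound\<close>
  show that no term exceeds the order \<open>E\<^sup>2\<close>.
\<close>

lemma jones_head_bound:
  obtains C where "C \<ge> 0" "\<And>N m. m < N \<Longrightarrow> \<bar>jones_head N m\<bar> \<le> C * (peak N)\<^sup>2"
proof -
  obtain C where C: "C > 0" "\<And>N K. K \<le> N \<Longrightarrow> half_sine_prod N K / peak N
      \<le> C * exp (- (pi / 100) * (real K - 5 * (real N + 1 / 2) / 6)\<^sup>2 / (real N + 1 / 2))"
    "\<And>N K. 1 \<le> K \<Longrightarrow> K \<le> N \<Longrightarrow> 1 / half_sine_prod N K \<le> C * peak N"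
    using half_sine_prod_gaussian_bound unfolding peak_def by metis
  have upper: "half_sine_prod N K \<le> C * peak N" if "K \<le> N" for N K
  proof -
    have "C * exp (- (pi / 100) * (real K - 5 * (real N + 1 / 2) / 6)\<^sup>2 / (real N + 1 / 2)) \<le> C * 1"
      using C(1) by (intro mult_left_mono) auto
    with C(2)[OF that] have "half_sine_prod N K / peak N \<le> C" by linarith
    then show ?thesis using peak_pos[of N] by (simp add: field_simps)
  qed
  have "\<bar>jones_head N m\<bar> \<le> C\<^sup>2 * (peak N)\<^sup>2" if m: "m < N" for N m
    unfolding jones_head_def
  proof (rule abs_alternating_sum_unimodal_le)
    let ?n = "real N + 1 / 2"
    let ?b = "\<lambda>k. half_sine_prod N (m + k + 1) / half_sine_prod N (m - k)"
    show "0 \<le> C\<^sup>2 * (peak N)\<^sup>2" by simp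
    have b_pos: "?b k > 0" if "k < min m (N - m)" for k
      using that m by (intro divide_pos_pos half_sine_prod_pos) auto
    show "0 \<le> ?b k \<and> ?b k \<le> C\<^sup>2 * (peak N)\<^sup>2" if k: "k < min m (N - m)" for k
    proof
      show "0 \<le> ?b k" using b_pos[OF k] by simp
      have "?b k = half_sine_prod N (m + k + 1) * (1 / half_sine_prod N (m - k))" by simp
      also have "\<dots> \<le> (C * peak N) * (C * peak N)"
        using k m C(1) peak_pos[of N]
        by (intro mult_mono upper C(3)) (auto intro!: less_imp_le[OF half_sine_prod_pos])
      finally show "?b k \<le> C\<^sup>2 * (peak N)\<^sup>2" by (simp add: power2_eq_square mult_ac)
    qed
    define \<rho> where "\<rho> = (\<lambda>k::nat. 2 * (cos (2 * (pi * (real k + 1) / ?n)) - cos (2 * (pi * (real m + 1 / 2) / ?n))))"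
    have ratio: "?b (Suc k) = ?b k * \<rho> k" if k: "Suc k < min m (N - m)" for k
    proof -
      define u where "u = pi * (real m + 1 / 2) / ?n"
      define v where "v = pi * (real k + 1) / ?n"
      have "m - k = Suc (m - Suc k)" using k by linarith
      then have 1: "half_sine_prod N (m - k) =
          half_sine_prod N (m - Suc k) * (2 * sin (pi * (real (m - Suc k) + 1 / 2) / ?n))"
        by (metis half_sine_prod_Suc)
      have "pi * (real (m - Suc k) + 1 / 2) / ?n = u - v"
        using k by (simp add: u_def v_def of_nat_diff algebra_simps flip: diff_divide_distrib)
      with 1 have 1: "half_sine_prod N (m - k) = half_sine_prod N (m - Suc k) * (2 * sin (u - v))"
        by simp
      have "pi * (real (m + k + 1) + 1 / 2) / ?n = u + v"
        by (simp add: u_def v_def algebra_simps flip: add_divide_distrib)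
      then have 2: "half_sine_prod N (m + Suc k + 1) = half_sine_prod N (m + k + 1) * (2 * sin (u + v))"
        using half_sine_prod_Suc[of N "m + k + 1"] by (simp add: add_ac)
      have "half_sine_prod N (m - k) > 0" using m by (intro half_sine_prod_pos) auto
      then have nz: "sin (u - v) \<noteq> 0" "half_sine_prod N (m - Suc k) \<noteq> 0" using 1 by auto
      have "\<rho> k = 4 * (sin (u + v) * sin (u - v))"
        unfolding \<rho>_def u_def[symmetric] v_def[symmetric]
        by (subst sin_times_sin) (simp add: algebra_simps)
      then show ?thesis unfolding 1 2 using nz by (simp add: field_simps)
    qed
    show "?b (Suc (Suc k)) \<le> ?b (Suc k)"
      if k: "Suc (Suc k) < min m (N - m)" and le: "?b (Suc k) \<le> ?b k" for k
    proof -
      have "?b k * \<rho> k \<le> ?b k * 1" using le ratio[of k] k by simp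
      then have "\<rho> k \<le> 1" using b_pos[of k] k by (subst (asm) mult_le_cancel_left_pos) auto
      have "cos (2 * (pi * (real (Suc k) + 1) / ?n)) \<le> cos (2 * (pi * (real k + 1) / ?n))"
      proof (rule cos_monotone_0_pi_le)
        have "2 * (real (Suc k) + 1) \<le> ?n" using k by (simp add: min_def split: if_splits)
        then have "pi * (2 * (real (Suc k) + 1)) \<le> pi * ?n" by (intro mult_left_mono) auto
        then show "2 * (pi * (real (Suc k) + 1) / ?n) \<le> pi" by (simp add: divide_le_eq mult_ac)
        show "2 * (pi * (real k + 1) / ?n) \<le> 2 * (pi * (real (Suc k) + 1) / ?n)"
          by (intro mult_left_mono divide_right_mono) auto
      qed auto
      then have "\<rho> (Suc k) \<le> \<rho> k" by (simp add: \<rho>_def)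
      with \<open>\<rho> k \<le> 1\<close> have "?b (Suc k) * \<rho> (Suc k) \<le> ?b (Suc k) * 1"
        using b_pos[of "Suc k"] k by (intro mult_left_mono) auto
      then show ?thesis using ratio[of "Suc k"] k by simp
    qed
  qed
  then show ?thesis using that[of "C\<^sup>2"] by auto
qed

section \<open>Gaussian limit of the bulk\<close>

text \<open>
  Extending the normalized products by zero to all integers absorbs the limits of the summations.
\<close>

definition scaled_prod :: "nat \<Rightarrow> int \<Rightarrow> real" where
  "scaled_prod N i = (if 0 \<le> i \<and> i \<le> int N then half_sine_prod N (nat i) / peak N else 0)"

lemma scaled_prod_nonneg: "0 \<le> scaled_prod N i"
  using half_sine_prod_pos[of "nat i" N] peak_pos[of N]
  by (auto simp: scaled_prod_def nat_le_iff intro!: divide_nonneg_pos)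

lemma scaled_prod_bound:
  obtains C where "C > 0" "\<And>N i. scaled_prod N i
      \<le> C * exp (- (pi / 100) * (real_of_int i - 5 * (real N + 1 / 2) / 6)\<^sup>2 / (real N + 1 / 2))"
proof -
  obtain C where C: "C > 0" "\<And>N K. K \<le> N \<Longrightarrow> half_sine_prod N K / peak N
      \<le> C * exp (- (pi / 100) * (real K - 5 * (real N + 1 / 2) / 6)\<^sup>2 / (real N + 1 / 2))"
    using half_sine_prod_gaussian_bound unfolding peak_def by metis
  have "scaled_prod N i
      \<le> C * exp (- (pi / 100) * (real_of_int i - 5 * (real N + 1 / 2) / 6)\<^sup>2 / (real N + 1 / 2))" for N i
  proof (cases "0 \<le> i \<and> i \<le> int N")
    case True
    then show ?thesis using C(2)[of "nat i" N] by (simp only: scaled_prod_def nat_le_iff of_nat_nat if_True simp_thms)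
  next
    case False
    then have "scaled_prod N i = 0" by (simp only: scaled_prod_def if_False)
    then show ?thesis using C(1) by simp
  qed
  then show ?thesis using that C(1) by blast
qed

lemma scaled_prod_local_limit:
  fixes \<kappa> :: "nat \<Rightarrow> int"
  assumes \<kappa>: "(\<lambda>N. (real_of_int (\<kappa> N) - 5 * (real N + 1 / 2) / 6) / sqrt (real N + 1 / 2)) \<longlonglongrightarrow> y"
  shows "(\<lambda>N. scaled_prod N (\<kappa> N)) \<longlonglongrightarrow> sqrt 2 * exp (- (sqrt 3 * pi / 2) * y\<^sup>2)"
proof -
  define n where "n = (\<lambda>N. real N + 1 / 2)"
  have n: "n N > 0" for N by (simp add: n_def)
  define Y where "Y = (\<lambda>N. (real_of_int (\<kappa> N) - 5 * n N / 6) / sqrt (n N))"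
  have "(\<lambda>N. 5 / 6 + Y N * (1 / sqrt (n N))) \<longlonglongrightarrow> 5 / 6 + y * 0"
  proof (intro tendsto_intros)
    show "Y \<longlonglongrightarrow> y" using \<kappa> by (simp add: Y_def n_def)
    show "(\<lambda>N. 1 / sqrt (n N)) \<longlonglongrightarrow> 0" unfolding n_def by real_asymp
  qed
  moreover have "5 / 6 + Y N * (1 / sqrt (n N)) = real_of_int (\<kappa> N) / n N" for N
  proof -
    have "Y N * (1 / sqrt (n N)) = (real_of_int (\<kappa> N) - 5 * n N / 6) / (sqrt (n N) * sqrt (n N))"
      by (simp add: Y_def)
    also have "sqrt (n N) * sqrt (n N) = n N" using n[of N] by simp
    finally show ?thesis using n[of N] by (simp add: field_simps)
  qed
  ultimately have ratio: "(\<lambda>N. real_of_int (\<kappa> N) / n N) \<longlonglongrightarrow> 5 / 6" by simp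
  have "\<forall>\<^sub>F N in sequentially. real_of_int (\<kappa> N) / n N > 0"
    "\<forall>\<^sub>F N in sequentially. real_of_int (\<kappa> N) / n N < 11 / 12"
    "\<forall>\<^sub>F N in sequentially. 11 / 12 * n N \<le> real N"
    by (rule order_tendstoD[OF ratio], simp)+ (unfold n_def, real_asymp)
  then have range: "\<forall>\<^sub>F N in sequentially. 0 \<le> \<kappa> N \<and> \<kappa> N \<le> int N"
  proof eventually_elim
    case (elim N)
    then have "0 < real_of_int (\<kappa> N)" "real_of_int (\<kappa> N) < 11 / 12 * n N"
      using n[of N] by (auto simp: zero_less_divide_iff divide_less_eq)
    then show ?case using elim(3) by linarith
  qed
  have "(\<lambda>N. (real (nat (\<kappa> N)) - 5 * n N / 6) / sqrt (n N)) \<longlonglongrightarrow> y"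
    by (rule Lim_transform_eventually[OF \<kappa>])
       (use range in \<open>auto elim!: eventually_mono simp: n_def\<close>)
  then have "(\<lambda>N. half_sine_prod N (nat (\<kappa> N)) / peak N) \<longlonglongrightarrow> sqrt 2 * exp (- (sqrt 3 * pi / 2) * y\<^sup>2)"
    using half_sine_prod_local_limit[of "\<lambda>N. nat (\<kappa> N)" y] by (simp add: n_def peak_def)
  then show ?thesis
    by (rule Lim_transform_eventually)
       (use range in \<open>auto elim!: eventually_mono simp: scaled_prod_def\<close>)
qed

definition peak_index :: "nat \<Rightarrow> int" where
  "peak_index N = \<lfloor>5 * (real N + 1 / 2) / 6\<rfloor>"

text \<open>
  The terms of the bulk, indexed by the distance \<open>t\<close> of \<open>k\<close> from the peak.
\<close>

definition bulk_term :: "nat \<Rightarrow> nat \<Rightarrow> int \<Rightarrow> real" where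
  "bulk_term N m t =
     (let k = peak_index N + t in scaled_prod N (k - int m) * scaled_prod N (k + int m + 1))"

lemma peak_index_nonneg: "0 \<le> peak_index N"
  by (simp add: peak_index_def)

lemma peak_index_le: "peak_index N \<le> int N"
  unfolding peak_index_def by (simp add: floor_le_iff)

lemma peak_index_close: "\<bar>real_of_int (peak_index N) + 1 / 2 - 5 * (real N + 1 / 2) / 6\<bar> \<le> 1 / 2"
  unfolding peak_index_def abs_le_iff by (intro conjI) linarith+

lemma bulk_term_nonneg: "0 \<le> bulk_term N m t"
  by (simp add: bulk_term_def Let_def scaled_prod_nonneg)

lemma bulk_term_eq_0:
  assumes "\<bar>t\<bar> > int N"
  shows "bulk_term N m t = 0"
proof (rule ccontr)
  assume "bulk_term N m t \<noteq> 0"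
  then have "0 \<le> peak_index N + t - int m" "peak_index N + t + int m + 1 \<le> int N"
    by (auto simp: bulk_term_def Let_def scaled_prod_def split: if_splits)
  then show False using peak_index_nonneg[of N] peak_index_le[of N] assms by linarith
qed

lemma sum_bulk_term:
  "(\<Sum>t = - int N..int N. bulk_term N m t) = jones_bulk N m / (peak N)\<^sup>2"
proof -
  define c where "c = peak_index N"
  have c: "0 \<le> c" "c \<le> int N" using peak_index_nonneg peak_index_le by (simp_all add: c_def)
  have "jones_bulk N m / (peak N)\<^sup>2 = (\<Sum>k = m..<N - m. bulk_term N m (int k - c))"
    unfolding jones_bulk_def sum_divide_distrib
  proof (rule sum.cong[OF refl])
    fix k assume k: "k \<in> {m..<N - m}"
    then have "nat (int k - int m) = k - m" "nat (int k + int m + 1) = k + m + 1"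
      "int k + int m + 1 \<le> int N"
      by (auto simp: nat_diff_distrib)
    then show "half_sine_prod N (k - m) * half_sine_prod N (k + m + 1) / (peak N)\<^sup>2 = bulk_term N m (int k - c)"
      using k by (simp add: bulk_term_def Let_def scaled_prod_def power2_eq_square flip: c_def)
  qed
  also have "\<dots> = (\<Sum>t \<in> (\<lambda>k. int k - c) ` {m..<N - m}. bulk_term N m t)"
    by (subst sum.reindex) (auto simp: inj_on_def)
  also have "\<dots> = (\<Sum>t = - int N..int N. bulk_term N m t)"
  proof (rule sum.mono_neutral_left)
    show "(\<lambda>k. int k - c) ` {m..<N - m} \<subseteq> {- int N..int N}" using c by auto
    show "\<forall>t\<in>{- int N..int N} - (\<lambda>k. int k - c) ` {m..<N - m}. bulk_term N m t = 0"
    proof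
      fix t assume t: "t \<in> {- int N..int N} - (\<lambda>k. int k - c) ` {m..<N - m}"
      show "bulk_term N m t = 0"
      proof (rule ccontr)
        assume "bulk_term N m t \<noteq> 0"
        then have "0 \<le> c + t - int m" "c + t + int m + 1 \<le> int N"
          by (auto simp: bulk_term_def Let_def scaled_prod_def split: if_splits simp flip: c_def)
        then have "nat (c + t) \<in> {m..<N - m}" "t = int (nat (c + t)) - c" by auto
        then show False using t by blast
      qed
    qed
  qed auto
  finally show ?thesis by simp
qed

text \<open>
  If \<open>\<tau>\<close> and \<open>\<mu>\<close> denote \<open>t\<close> and \<open>m\<close> up to bounded shifts, the two arguments lie at the distances \<open>\<tau> - \<mu>\<close> and
  \<open>\<tau> + \<mu>\<close> from the peak, and \<open>(\<tau> - \<mu>)\<^sup>2 + (\<tau> + \<mu>)\<^sup>2 = 2\<tau>\<^sup>2 + 2\<mu>\<^sup>2\<close> separates the Gaussian bound into a factor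
  in \<open>m\<close> and a factor in \<open>t\<close>.
\<close>

lemma bulk_term_bound:
  obtains C where "C > 0" "\<And>N m t. bulk_term N m t \<le>
    C * exp (- (pi / 100) * (real m / sqrt (real N + 1 / 2))\<^sup>2)
      * exp (- (pi / 100) * (real_of_int t / sqrt (real N + 1 / 2))\<^sup>2)"
proof -
  obtain C where C: "C > 0" "\<And>N i. scaled_prod N i
      \<le> C * exp (- (pi / 100) * (real_of_int i - 5 * (real N + 1 / 2) / 6)\<^sup>2 / (real N + 1 / 2))"
    using scaled_prod_bound by blast
  have "bulk_term N m t \<le> C\<^sup>2 * exp (pi / 100) *
      exp (- (pi / 100) * (real m / sqrt (real N + 1 / 2))\<^sup>2)
      * exp (- (pi / 100) * (real_of_int t / sqrt (real N + 1 / 2))\<^sup>2)" for N m t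
  proof -
    define n where "n = real N + 1 / 2"
    have n: "n \<ge> 1 / 2" by (simp add: n_def)
    define k where "k = peak_index N + t"
    \<comment> \<open>The offset, for \<open>t = 0\<close>, of the midpoint of the two indices from the exact peak \<open>5n/6\<close>.\<close>
    define \<theta> where "\<theta> = real_of_int (peak_index N) + 1 / 2 - 5 * n / 6"
    define u where "u = real_of_int (k - int m) - 5 * n / 6"
    define v where "v = real_of_int (k + int m + 1) - 5 * n / 6"
    have uv: "u = real_of_int t + \<theta> - (real m + 1 / 2)" "v = real_of_int t + \<theta> + (real m + 1 / 2)"
      by (simp_all add: u_def v_def k_def \<theta>_def)
    have "\<bar>\<theta>\<bar> \<le> 1 / 2" unfolding \<theta>_def n_def by (rule peak_index_close)
    then have "\<theta>\<^sup>2 \<le> (1 / 2)\<^sup>2" by (metis abs_ge_zero power2_abs power_mono)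
    moreover have "u\<^sup>2 + v\<^sup>2 = (real_of_int t)\<^sup>2 + (real m)\<^sup>2 - 2 * \<theta>\<^sup>2
        + ((real_of_int t + 2 * \<theta>)\<^sup>2 + (real m + 1)\<^sup>2 - 1 / 2)"
      unfolding uv by (simp add: power2_eq_square algebra_simps)
    moreover have "0 \<le> (real_of_int t + 2 * \<theta>)\<^sup>2" "1\<^sup>2 \<le> (real m + 1)\<^sup>2" by (simp, intro power_mono) auto
    ultimately have ge: "(real_of_int t)\<^sup>2 + (real m)\<^sup>2 - 1 / 2 \<le> u\<^sup>2 + v\<^sup>2"
      by (simp add: power2_eq_square)
    have "bulk_term N m t = scaled_prod N (k - int m) * scaled_prod N (k + int m + 1)"
      by (simp only: bulk_term_def Let_def k_def)
    also have "\<dots> \<le> (C * exp (- (pi / 100) * u\<^sup>2 / n)) * (C * exp (- (pi / 100) * v\<^sup>2 / n))"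
      unfolding u_def v_def n_def using C(1) by (intro mult_mono C(2) scaled_prod_nonneg) auto
    also have "\<dots> = C\<^sup>2 * exp (- (pi / 100) * u\<^sup>2 / n + - (pi / 100) * v\<^sup>2 / n)"
      unfolding exp_add by (simp only: power2_eq_square mult_ac)
    also have "\<dots> \<le> C\<^sup>2 * exp (pi / 100 + - (pi / 100) * (real m / sqrt n)\<^sup>2 + - (pi / 100) * (real_of_int t / sqrt n)\<^sup>2)"
    proof -
      have "pi / 100 * ((real_of_int t)\<^sup>2 + (real m)\<^sup>2 - 1 / 2) / n \<le> pi / 100 * (u\<^sup>2 + v\<^sup>2) / n"
        using n ge by (intro divide_right_mono mult_left_mono) auto
      moreover have "pi / 100 * (1 / 2) / n \<le> pi / 100"
        using n by (simp add: field_simps)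
      moreover have "(real m / sqrt n)\<^sup>2 = (real m)\<^sup>2 / n" "(real_of_int t / sqrt n)\<^sup>2 = (real_of_int t)\<^sup>2 / n"
        using n by (simp_all add: power_divide)
      ultimately show ?thesis
        by (intro mult_left_mono) (simp_all add: algebra_simps add_divide_distrib diff_divide_distrib)
    qed
    also have "\<dots> = C\<^sup>2 * exp (pi / 100) *
      exp (- (pi / 100) * (real m / sqrt n)\<^sup>2) * exp (- (pi / 100) * (real_of_int t / sqrt n)\<^sup>2)"
      by (simp only: exp_add mult_ac)
    finally show ?thesis by (simp add: n_def)
  qed
  then show ?thesis using that[of "C\<^sup>2 * exp (pi / 100)"] C(1) by simp
qed

lemma sqrt_half_integer_ge: "1 / 2 \<le> sqrt (real N + 1 / 2)"
  by (rule real_le_rsqrt) (simp add: power2_eq_square)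

lemma floor_scaled_limit:
  "(\<lambda>N. real_of_int \<lfloor>y * sqrt (real N + 1 / 2)\<rfloor> / sqrt (real N + 1 / 2)) \<longlonglongrightarrow> y"
proof (rule real_tendsto_sandwich)
  have s: "sqrt (real N + 1 / 2) > 0" for N by simp
  show "\<forall>\<^sub>F N in sequentially. y - 1 / sqrt (real N + 1 / 2) \<le> real_of_int \<lfloor>y * sqrt (real N + 1 / 2)\<rfloor> / sqrt (real N + 1 / 2)"
  proof (intro always_eventually allI)
    fix N
    have "(y * sqrt (real N + 1 / 2) - 1) / sqrt (real N + 1 / 2)
        \<le> real_of_int \<lfloor>y * sqrt (real N + 1 / 2)\<rfloor> / sqrt (real N + 1 / 2)"
      using s[of N] by (intro divide_right_mono) linarith+
    then show "y - 1 / sqrt (real N + 1 / 2) \<le> real_of_int \<lfloor>y * sqrt (real N + 1 / 2)\<rfloor> / sqrt (real N + 1 / 2)"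
      using s[of N] by (simp add: diff_divide_distrib)
  qed
  show "\<forall>\<^sub>F N in sequentially. real_of_int \<lfloor>y * sqrt (real N + 1 / 2)\<rfloor> / sqrt (real N + 1 / 2) \<le> y"
    using s by (intro always_eventually allI) (simp add: divide_le_eq)
  have "(\<lambda>N. y - 1 / sqrt (real N + 1 / 2)) \<longlonglongrightarrow> y - 0"
    by (intro tendsto_intros) real_asymp
  then show "(\<lambda>N. y - 1 / sqrt (real N + 1 / 2)) \<longlonglongrightarrow> y" by simp
qed auto

lemma sum_gaussian_bound:
  fixes c :: real
  assumes c: "c > 0"
  obtains D where "D > 0" "\<And>N. (\<Sum>t = - int N..int N. exp (- c * (real_of_int t / sqrt (real N + 1 / 2))\<^sup>2))
    \<le> D * sqrt (real N + 1 / 2)"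
proof -
  define s where "s = (\<lambda>N. sqrt (real N + 1 / 2))"
  define f where "f = (\<lambda>N t. if \<bar>t\<bar> \<le> int N then exp (- c * (real_of_int t / s N)\<^sup>2) else 0)"
  have "(\<lambda>N. (\<Sum>t = - int N..int N. f N t) / s N) \<longlonglongrightarrow> (\<integral>y. exp (- c * y\<^sup>2) \<partial>lborel)"
  proof (rule riemann_sum_gaussian_dominated[OF _ c, where C = 1])
    fix y :: real
    have "filterlim (\<lambda>N. real N / s N) at_top sequentially" unfolding s_def by real_asymp
    then have "\<forall>\<^sub>F N in sequentially. \<bar>y\<bar> + 2 \<le> real N / s N" by (simp only: filterlim_at_top)
    then have "\<forall>\<^sub>F N in sequentially. exp (- c * (real_of_int \<lfloor>y * s N\<rfloor> / s N)\<^sup>2) = f N \<lfloor>y * s N\<rfloor>"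
    proof eventually_elim
      case (elim N)
      have s: "1 / 2 \<le> s N" unfolding s_def by (rule sqrt_half_integer_ge)
      then have "\<bar>y * s N\<bar> + 2 * s N \<le> real N"
        using elim by (simp add: pos_le_divide_eq abs_mult distrib_right)
      then have "\<bar>\<lfloor>y * s N\<rfloor>\<bar> \<le> int N" using s by linarith
      then show ?case by (simp add: f_def)
    qed
    moreover have "(\<lambda>N. exp (- c * (real_of_int \<lfloor>y * s N\<rfloor> / s N)\<^sup>2)) \<longlonglongrightarrow> exp (- c * y\<^sup>2)"
      unfolding s_def by (intro tendsto_intros floor_scaled_limit)
    ultimately show "(\<lambda>N. f N \<lfloor>y * s N\<rfloor>) \<longlonglongrightarrow> exp (- c * y\<^sup>2)"
      by (rule Lim_transform_eventually[rotated])
  qed (auto simp: f_def s_def sqrt_half_integer_ge[simplified])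
  then obtain D where D: "D > 0" "\<And>N. \<bar>(\<Sum>t = - int N..int N. f N t) / s N\<bar> \<le> D"
    using convergent_imp_Bseq[of "\<lambda>N. (\<Sum>t = - int N..int N. f N t) / s N"]
    by (auto simp: convergent_def Bseq_def)
  show ?thesis
  proof (rule that[OF D(1)])
    fix N
    have "(\<Sum>t = - int N..int N. exp (- c * (real_of_int t / s N)\<^sup>2)) = (\<Sum>t = - int N..int N. f N t)"
      by (intro sum.cong) (auto simp: f_def)
    moreover have "s N > 0" by (simp add: s_def)
    moreover have "(\<Sum>t = - int N..int N. f N t) / s N \<le> D" using D(2)[of N] by linarith
    ultimately have "(\<Sum>t = - int N..int N. exp (- c * (real_of_int t / s N)\<^sup>2)) \<le> D * s N"
      by (simp only: pos_divide_le_eq)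
    then show "(\<Sum>t = - int N..int N. exp (- c * (real_of_int t / sqrt (real N + 1 / 2))\<^sup>2))
        \<le> D * sqrt (real N + 1 / 2)"
      by (simp only: s_def)
  qed
qed

definition scaled_bulk :: "nat \<Rightarrow> nat \<Rightarrow> real" where
  "scaled_bulk N m = jones_bulk N m / ((peak N)\<^sup>2 * sqrt (real N + 1 / 2))"

lemma scaled_bulk_eq: "scaled_bulk N m = (\<Sum>t = - int N..int N. bulk_term N m t) / sqrt (real N + 1 / 2)"
  by (simp add: scaled_bulk_def sum_bulk_term)

lemma scaled_bulk_nonneg: "0 \<le> scaled_bulk N m"
  unfolding scaled_bulk_eq by (intro divide_nonneg_nonneg sum_nonneg bulk_term_nonneg) auto

lemma scaled_bulk_bound:
  obtains C where "C > 0"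
    "\<And>N m. scaled_bulk N m \<le> C * exp (- (pi / 100) * (real m / sqrt (real N + 1 / 2))\<^sup>2)"
proof -
  obtain C where C: "C > 0" "\<And>N m t. bulk_term N m t \<le>
    C * exp (- (pi / 100) * (real m / sqrt (real N + 1 / 2))\<^sup>2)
      * exp (- (pi / 100) * (real_of_int t / sqrt (real N + 1 / 2))\<^sup>2)"
    using bulk_term_bound by blast
  obtain D where D: "D > 0" "\<And>N. (\<Sum>t = - int N..int N. exp (- (pi / 100) * (real_of_int t / sqrt (real N + 1 / 2))\<^sup>2))
    \<le> D * sqrt (real N + 1 / 2)"
    using sum_gaussian_bound[of "pi / 100"] by auto
  have "scaled_bulk N m \<le> (C * D) * exp (- (pi / 100) * (real m / sqrt (real N + 1 / 2))\<^sup>2)" for N m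
  proof -
    let ?s = "sqrt (real N + 1 / 2)"
    let ?g = "C * exp (- (pi / 100) * (real m / ?s)\<^sup>2)"
    have "(\<Sum>t = - int N..int N. bulk_term N m t) \<le>
        (\<Sum>t = - int N..int N. ?g * exp (- (pi / 100) * (real_of_int t / ?s)\<^sup>2))"
      by (intro sum_mono C(2))
    also have "\<dots> = ?g * (\<Sum>t = - int N..int N. exp (- (pi / 100) * (real_of_int t / ?s)\<^sup>2))"
      by (simp only: sum_distrib_left)
    also have "\<dots> \<le> ?g * (D * ?s)"
      using C(1) by (intro mult_left_mono D(2)) auto
    finally have "scaled_bulk N m \<le> ?g * (D * ?s) / ?s"
      unfolding scaled_bulk_eq by (intro divide_right_mono) auto
    also have "\<dots> = ?g * D" by simp
    finally show ?thesis by (simp add: mult_ac)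
  qed
  then show ?thesis using that[of "C * D"] C(1) D(1) by simp
qed

text \<open>
  The sum over \<open>t\<close> is a Riemann sum for \<open>\<integral> 2 exp (- \<surd>3 \<pi> (x\<^sup>2 + y\<^sup>2)) dy\<close>.
\<close>

lemma scaled_bulk_limit:
  fixes m :: "nat \<Rightarrow> nat"
  assumes m: "(\<lambda>N. real (m N) / sqrt (real N + 1 / 2)) \<longlonglongrightarrow> x"
  shows "(\<lambda>N. scaled_bulk N (m N)) \<longlonglongrightarrow> 2 * exp (- (sqrt 3 * pi) * x\<^sup>2) * sqrt (1 / sqrt 3)"
proof -
  define s where "s = (\<lambda>N. sqrt (real N + 1 / 2))"
  define c where "c = peak_index"
  have s0: "(\<lambda>N. 1 / s N) \<longlonglongrightarrow> 0" unfolding s_def by real_asymp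
  have center: "(\<lambda>N. (real_of_int (c N) - 5 * (real N + 1 / 2) / 6) / s N) \<longlonglongrightarrow> 0"
  proof (rule Lim_null_comparison[OF _ s0])
    have "\<bar>p - x\<bar> \<le> 1" if "\<bar>p + 1 / 2 - x\<bar> \<le> 1 / 2" for p x :: real
      using abs_le_D1[OF that] abs_le_D2[OF that] by linarith
    then have "\<bar>real_of_int (c N) - 5 * (real N + 1 / 2) / 6\<bar> \<le> 1" for N
      using peak_index_close[of N] unfolding c_def by blast
    moreover have "s N > 0" for N by (simp add: s_def)
    ultimately show "\<forall>\<^sub>F N in sequentially. norm ((real_of_int (c N) - 5 * (real N + 1 / 2) / 6) / s N) \<le> 1 / s N"
      by (intro always_eventually allI) (simp add: abs_divide divide_right_mono less_imp_le)
  qed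
  have lim: "(\<lambda>N. bulk_term N (m N) \<lfloor>y * s N\<rfloor>) \<longlonglongrightarrow> 2 * exp (- (sqrt 3 * pi) * x\<^sup>2) * exp (- (sqrt 3 * pi) * y\<^sup>2)" for y
  proof -
    have y: "(\<lambda>N. real_of_int \<lfloor>y * s N\<rfloor> / s N) \<longlonglongrightarrow> y"
      unfolding s_def by (rule floor_scaled_limit)
    have m': "(\<lambda>N. real (m N) / s N) \<longlonglongrightarrow> x" using m by (simp add: s_def)
    have "(\<lambda>N. (real_of_int (c N) - 5 * (real N + 1 / 2) / 6) / s N + real_of_int \<lfloor>y * s N\<rfloor> / s N - real (m N) / s N)
        \<longlonglongrightarrow> 0 + y - x"
      by (intro tendsto_intros center y m')
    then have "(\<lambda>N. (real_of_int (c N + \<lfloor>y * s N\<rfloor> - int (m N)) - 5 * (real N + 1 / 2) / 6) / s N) \<longlonglongrightarrow> y - x"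
      by (simp add: add_divide_distrib diff_divide_distrib algebra_simps)
    then have 1: "(\<lambda>N. scaled_prod N (c N + \<lfloor>y * s N\<rfloor> - int (m N))) \<longlonglongrightarrow> sqrt 2 * exp (- (sqrt 3 * pi / 2) * (y - x)\<^sup>2)"
      unfolding s_def by (rule scaled_prod_local_limit)
    have "(\<lambda>N. (real_of_int (c N) - 5 * (real N + 1 / 2) / 6) / s N + real_of_int \<lfloor>y * s N\<rfloor> / s N + real (m N) / s N + 1 / s N)
        \<longlonglongrightarrow> 0 + y + x + 0"
      by (intro tendsto_intros center y m' s0)
    then have "(\<lambda>N. (real_of_int (c N + \<lfloor>y * s N\<rfloor> + int (m N) + 1) - 5 * (real N + 1 / 2) / 6) / s N) \<longlonglongrightarrow> y + x"
      by (simp add: add_divide_distrib diff_divide_distrib algebra_simps)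
    then have 2: "(\<lambda>N. scaled_prod N (c N + \<lfloor>y * s N\<rfloor> + int (m N) + 1)) \<longlonglongrightarrow> sqrt 2 * exp (- (sqrt 3 * pi / 2) * (y + x)\<^sup>2)"
      unfolding s_def by (rule scaled_prod_local_limit)
    have "(sqrt 2 * exp (- (sqrt 3 * pi / 2) * (y - x)\<^sup>2)) * (sqrt 2 * exp (- (sqrt 3 * pi / 2) * (y + x)\<^sup>2)) =
        (sqrt 2 * sqrt 2) * exp (- (sqrt 3 * pi / 2) * (y - x)\<^sup>2 + - (sqrt 3 * pi / 2) * (y + x)\<^sup>2)"
      by (simp only: exp_add mult_ac)
    also have "- (sqrt 3 * pi / 2) * (y - x)\<^sup>2 + - (sqrt 3 * pi / 2) * (y + x)\<^sup>2 =
        - (sqrt 3 * pi) * x\<^sup>2 + - (sqrt 3 * pi) * y\<^sup>2"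
      by (simp add: power2_eq_square field_simps)
    finally have "(sqrt 2 * exp (- (sqrt 3 * pi / 2) * (y - x)\<^sup>2)) * (sqrt 2 * exp (- (sqrt 3 * pi / 2) * (y + x)\<^sup>2)) =
        2 * exp (- (sqrt 3 * pi) * x\<^sup>2) * exp (- (sqrt 3 * pi) * y\<^sup>2)"
      by (simp only: exp_add) simp
    with tendsto_mult[OF 1 2] show ?thesis
      by (simp only: bulk_term_def Let_def c_def)
  qed
  obtain C where C: "C > 0" "\<And>N m t. bulk_term N m t \<le>
    C * exp (- (pi / 100) * (real m / sqrt (real N + 1 / 2))\<^sup>2)
      * exp (- (pi / 100) * (real_of_int t / sqrt (real N + 1 / 2))\<^sup>2)"
    using bulk_term_bound by blast
  have "(\<lambda>N. (\<Sum>t = - int N..int N. bulk_term N (m N) t) / s N) \<longlonglongrightarrow>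
      (\<integral>y. 2 * exp (- (sqrt 3 * pi) * x\<^sup>2) * exp (- (sqrt 3 * pi) * y\<^sup>2) \<partial>lborel)"
  proof (rule riemann_sum_gaussian_dominated[where c = "pi / 100" and C = C])
    show "\<bar>bulk_term N (m N) t\<bar> \<le> C * exp (- (pi / 100) * (real_of_int t / s N)\<^sup>2)" for N t
    proof -
      have "C * exp (- (pi / 100) * (real (m N) / s N)\<^sup>2) * exp (- (pi / 100) * (real_of_int t / s N)\<^sup>2)
          \<le> C * 1 * exp (- (pi / 100) * (real_of_int t / s N)\<^sup>2)"
        using C(1) by (intro mult_right_mono mult_left_mono) auto
      with C(2)[of N "m N" t] bulk_term_nonneg[of N "m N" t] show ?thesis by (simp add: s_def)
    qed
  qed (use lim bulk_term_eq_0 sqrt_half_integer_ge in \<open>auto simp: s_def\<close>)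
  also have "(\<integral>y. 2 * exp (- (sqrt 3 * pi) * x\<^sup>2) * exp (- (sqrt 3 * pi) * y\<^sup>2) \<partial>lborel) =
      2 * exp (- (sqrt 3 * pi) * x\<^sup>2) * sqrt (1 / sqrt 3)"
    using has_bochner_integral_gaussian[of "sqrt 3 * pi"] by (simp add: has_bochner_integral_iff)
  finally show ?thesis by (simp add: scaled_bulk_eq s_def)
qed

section \<open>Asymptotics of the Turaev--Viro invariant\<close>

text \<open>
  Any range of \<open>m\<close> that is long on the scale \<open>\<surd>n\<close> gives the full integral of the square of
  the limit in \<open>scaled_bulk_limit\<close> over \<open>y \<ge> 0\<close>.
\<close>

lemma scaled_bulk_square_sum_limit:
  fixes w :: "nat \<Rightarrow> nat"
  assumes w: "\<And>N. w N \<le> N" and w_top: "filterlim (\<lambda>N. real (w N) / sqrt (real N + 1 / 2)) at_top sequentially"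
  shows "(\<lambda>N. (\<Sum>m<w N. (scaled_bulk N m)\<^sup>2) / sqrt (real N + 1 / 2)) \<longlonglongrightarrow> (2 / sqrt 3) powr (3 / 2) / 2"
proof -
  define s where "s = (\<lambda>N. sqrt (real N + 1 / 2))"
  have s_pos: "s N > 0" for N by (simp add: s_def)
  define G where "G = (\<lambda>N t. if 0 \<le> t \<and> t < int (w N) then (scaled_bulk N (nat t))\<^sup>2 else 0)"
  obtain C where C: "C > 0"
    "\<And>N m. scaled_bulk N m \<le> C * exp (- (pi / 100) * (real m / sqrt (real N + 1 / 2))\<^sup>2)"
    using scaled_bulk_bound by blast
  have "(\<lambda>N. (\<Sum>t = - int N..int N. G N t) / s N) \<longlonglongrightarrow>
    (\<integral>y. (4 / sqrt 3) * (indicator {0..} y * exp (- (2 * sqrt 3 * pi) * y\<^sup>2)) \<partial>lborel)"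
  proof (rule riemann_sum_gaussian_dominated[where c = "pi / 50" and C = "C\<^sup>2"])
    show "1 / 2 \<le> s N" for N unfolding s_def by (rule sqrt_half_integer_ge)
    show "\<bar>G N t\<bar> \<le> C\<^sup>2 * exp (- (pi / 50) * (real_of_int t / s N)\<^sup>2)" for N t
    proof (cases "0 \<le> t \<and> t < int (w N)")
      case True
      have "(scaled_bulk N (nat t))\<^sup>2 \<le> (C * exp (- (pi / 100) * (real (nat t) / s N)\<^sup>2))\<^sup>2"
        unfolding s_def by (intro power_mono C(2) scaled_bulk_nonneg)
      also have "\<dots> = C\<^sup>2 * exp (- (pi / 50) * (real_of_int t / s N)\<^sup>2)"
        using True by (simp add: power_mult_distrib flip: exp_double)
      finally show ?thesis using True by (simp add: G_def)
    next
      case False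
      then have "G N t = 0" by (simp only: G_def if_False)
      then show ?thesis by simp
    qed
    show "G N t = 0" if "\<bar>t\<bar> > int N" for N t
      using that w[of N] by (auto simp: G_def)
    show "(\<lambda>N. G N \<lfloor>y * s N\<rfloor>) \<longlonglongrightarrow> (4 / sqrt 3) * (indicator {0..} y * exp (- (2 * sqrt 3 * pi) * y\<^sup>2))"
      if y: "y \<noteq> 0" for y
    proof (cases "y > 0")
      case False
      then have "\<lfloor>y * s N\<rfloor> < 0" for N
        using y s_pos[of N] by (simp add: floor_less_zero mult_neg_pos)
      then have "G N \<lfloor>y * s N\<rfloor> = 0" for N
        unfolding G_def by (simp only: not_le[symmetric] simp_thms if_False)
      then show ?thesis using False y by simp
    next
      case True
      have nn: "0 \<le> \<lfloor>y * s N\<rfloor>" for N using True s_pos[of N] by simp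
      have "(\<lambda>N. real (nat \<lfloor>y * s N\<rfloor>) / s N) \<longlonglongrightarrow> y"
        using floor_scaled_limit[of y] nn by (simp add: s_def)
      then have "(\<lambda>N. (scaled_bulk N (nat \<lfloor>y * s N\<rfloor>))\<^sup>2) \<longlonglongrightarrow> (2 * exp (- (sqrt 3 * pi) * y\<^sup>2) * sqrt (1 / sqrt 3))\<^sup>2"
        unfolding s_def by (intro tendsto_power scaled_bulk_limit)
      also have "(2 * exp (- (sqrt 3 * pi) * y\<^sup>2) * sqrt (1 / sqrt 3))\<^sup>2 =
          (4 / sqrt 3) * (indicator {0..} y * exp (- (2 * sqrt 3 * pi) * y\<^sup>2))"
        using True by (simp add: power_mult_distrib flip: exp_double)
      finally have lim: "(\<lambda>N. (scaled_bulk N (nat \<lfloor>y * s N\<rfloor>))\<^sup>2) \<longlonglongrightarrow> \<dots>" .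
      have "\<forall>\<^sub>F N in sequentially. y + 1 \<le> real (w N) / s N"
        using w_top by (simp only: filterlim_at_top s_def)
      then have "\<forall>\<^sub>F N in sequentially. (scaled_bulk N (nat \<lfloor>y * s N\<rfloor>))\<^sup>2 = G N \<lfloor>y * s N\<rfloor>"
      proof eventually_elim
        case (elim N)
        then have "y * s N + s N \<le> real (w N)"
          using s_pos[of N] by (simp add: pos_le_divide_eq distrib_right)
        then have "\<lfloor>y * s N\<rfloor> < int (w N)" using s_pos[of N] by linarith
        then show ?case using nn by (simp add: G_def)
      qed
      with lim show ?thesis by (rule Lim_transform_eventually)
    qed
  qed simp_all
  also have "(\<integral>y. (4 / sqrt 3) * (indicator {0..} y * exp (- (2 * sqrt 3 * pi) * y\<^sup>2)) \<partial>lborel) =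
      (2 / sqrt 3) powr (3 / 2) / 2"
  proof -
    define a where "a = 2 / sqrt 3"
    have a: "a > 0" by (simp add: a_def)
    have "(\<integral>y. (4 / sqrt 3) * (indicator {0..} y * exp (- (2 * sqrt 3 * pi) * y\<^sup>2)) \<partial>lborel) =
        (4 / sqrt 3) * (sqrt (pi / (2 * sqrt 3 * pi)) / 2)"
      using has_bochner_integral_half_gaussian[of "2 * sqrt 3 * pi"] by (simp add: has_bochner_integral_iff)
    also have "\<dots> = 2 * a * (sqrt (a / 2\<^sup>2) / 2)" by (simp add: a_def)
    also have "2 * a * (sqrt (a / 2\<^sup>2) / 2) = a * a powr (1 / 2) / 2"
      using a by (simp only: real_sqrt_divide real_sqrt_abs powr_half_sqrt)
    also have "a * a powr (1 / 2) = a powr (3 / 2)"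
      using a powr_add[of a 1 "1 / 2"] by simp
    finally show ?thesis by (simp only: a_def)
  qed
  finally have lim: "(\<lambda>N. (\<Sum>t = - int N..int N. G N t) / s N) \<longlonglongrightarrow> (2 / sqrt 3) powr (3 / 2) / 2" .
  have G_sum: "(\<Sum>t = - int N..int N. G N t) = (\<Sum>m<w N. (scaled_bulk N m)\<^sup>2)" for N
  proof -
    have "(\<Sum>m<w N. (scaled_bulk N m)\<^sup>2) = (\<Sum>m<w N. G N (int m))"
      by (intro sum.cong refl) (simp add: G_def)
    also have "\<dots> = (\<Sum>t \<in> int ` {..<w N}. G N t)"
      by (subst sum.reindex) auto
    also have "\<dots> = (\<Sum>t = - int N..int N. G N t)"
    proof (rule sum.mono_neutral_left)
      show "int ` {..<w N} \<subseteq> {- int N..int N}" using w[of N] by auto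
      show "\<forall>t\<in>{- int N..int N} - int ` {..<w N}. G N t = 0"
        by (auto simp: G_def image_iff) (metis lessThan_iff nat_less_iff int_nat_eq)
    qed auto
    finally show ?thesis by simp
  qed
  show ?thesis using lim by (simp only: G_sum s_def)
qed

text \<open>
  The head is \<open>O(E\<^sup>2)\<close> for each \<open>m\<close>, against \<open>\<surd>n E\<^sup>2\<close> for the bulk. The squares of the head add up to
  \<open>O(n E\<^sup>4)\<close>, and so do the mixed terms since the sum of the bulk over \<open>m\<close> is \<open>O(n E\<^sup>2)\<close>; both are negligible against
  \<open>n\<^bsup>3/2\<^esup> E\<^sup>4\<close>.
\<close>

lemma jones_square_sum_limit:
  fixes w :: "nat \<Rightarrow> nat"
  assumes w: "\<And>N. w N \<le> N" and w_top: "filterlim (\<lambda>N. real (w N) / sqrt (real N + 1 / 2)) at_top sequentially"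
  shows "(\<lambda>N. (\<Sum>m<w N. (jones_head N m + (- 1) ^ m * jones_bulk N m)\<^sup>2) /
      ((peak N) ^ 4 * (sqrt (real N + 1 / 2)) ^ 3)) \<longlonglongrightarrow> (2 / sqrt 3) powr (3 / 2) / 2"
proof -
  define s where "s = (\<lambda>N. sqrt (real N + 1 / 2))"
  have s_pos: "s N > 0" for N by (simp add: s_def)
  have s2: "(s N)\<^sup>2 = real N + 1 / 2" for N by (simp add: s_def)
  obtain C where C: "C \<ge> 0" "\<And>N m. m < N \<Longrightarrow> \<bar>jones_head N m\<bar> \<le> C * (peak N)\<^sup>2"
    using jones_head_bound by blast
  obtain D where D: "D > 0"
    "\<And>N m. scaled_bulk N m \<le> D * exp (- (pi / 100) * (real m / sqrt (real N + 1 / 2))\<^sup>2)"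
    using scaled_bulk_bound by blast
  obtain B where B: "B > 0" "\<And>N. (\<Sum>t = - int N..int N. exp (- (pi / 100) * (real_of_int t / sqrt (real N + 1 / 2))\<^sup>2))
    \<le> B * sqrt (real N + 1 / 2)"
    using sum_gaussian_bound[of "pi / 100"] by auto
  define b where "b = scaled_bulk"
  \<comment> \<open>In units of \<open>E\<^sup>2 \<surd>n\<close> the head is \<open>O(1/\<surd>n)\<close> and the bulk is bounded.\<close>
  define h where "h = (\<lambda>N m. jones_head N m / ((peak N)\<^sup>2 * s N))"
  have h: "\<bar>h N m\<bar> \<le> C / s N" if "m < N" for N m
    using C(2)[OF that] peak_pos[of N] s_pos[of N]
    by (simp add: h_def abs_mult field_simps)
  have sum_b: "(\<Sum>m<w N. b N m) \<le> D * B * s N" for N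
  proof -
    have "(\<Sum>m<w N. b N m) \<le> (\<Sum>m<w N. D * exp (- (pi / 100) * (real_of_int (int m) / s N)\<^sup>2))"
      unfolding b_def s_def using D(2) by (intro sum_mono) simp
    also have "\<dots> = (\<Sum>t \<in> int ` {..<w N}. D * exp (- (pi / 100) * (real_of_int t / s N)\<^sup>2))"
      by (subst sum.reindex) auto
    also have "\<dots> \<le> (\<Sum>t = - int N..int N. D * exp (- (pi / 100) * (real_of_int t / s N)\<^sup>2))"
      using w[of N] D(1) by (intro sum_mono2) auto
    also have "\<dots> \<le> D * (B * s N)"
      unfolding s_def sum_distrib_left[symmetric] using D(1) by (intro mult_left_mono B(2)) auto
    finally show ?thesis by (simp add: mult.assoc)
  qed
  define R where "R = (\<lambda>N. (\<Sum>m<w N. (h N m + (- 1) ^ m * b N m)\<^sup>2) / s N)"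
  define Q where "Q = (\<lambda>N. (\<Sum>m<w N. (b N m)\<^sup>2) / s N)"
  have R_eq: "R N = (\<Sum>m<w N. (jones_head N m + (- 1) ^ m * jones_bulk N m)\<^sup>2) / ((peak N) ^ 4 * (s N) ^ 3)" for N
  proof -
    have "(h N m + (- 1) ^ m * b N m)\<^sup>2 / s N =
        (jones_head N m + (- 1) ^ m * jones_bulk N m)\<^sup>2 / ((peak N) ^ 4 * (s N) ^ 3)" for m
    proof -
      have "h N m + (- 1) ^ m * b N m = (jones_head N m + (- 1) ^ m * jones_bulk N m) / ((peak N)\<^sup>2 * s N)"
        by (simp add: h_def b_def scaled_bulk_def s_def add_divide_distrib)
      then show ?thesis
        by (simp add: power_divide power_mult_distrib power2_eq_square power3_eq_cube power4_eq_xxxx mult_ac)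
    qed
    then show ?thesis by (simp only: R_def sum_divide_distrib)
  qed
  have diff: "\<bar>R N - Q N\<bar> \<le> (C\<^sup>2 + 2 * C * D * B) * (1 / s N)" for N
  proof -
    have pt: "\<bar>(h N m + (- 1) ^ m * b N m)\<^sup>2 - (b N m)\<^sup>2\<bar> \<le> (C / s N)\<^sup>2 + 2 * (C / s N) * b N m"
      if m: "m < w N" for m
    proof -
      have hm: "\<bar>h N m\<bar> \<le> C / s N" using h m w[of N] by simp
      have b0: "b N m \<ge> 0" by (simp add: b_def scaled_bulk_nonneg)
      have "(h N m + (- 1) ^ m * b N m)\<^sup>2 - (b N m)\<^sup>2 = (h N m)\<^sup>2 + 2 * h N m * ((- 1) ^ m * b N m)"
        by (simp add: power2_sum power_mult_distrib flip: power_mult)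
      also have "\<bar>\<dots>\<bar> \<le> \<bar>h N m\<bar>\<^sup>2 + 2 * \<bar>h N m\<bar> * b N m"
        by (rule order_trans[OF abs_triangle_ineq]) (use b0 in \<open>simp add: abs_mult power_abs\<close>)
      also have "\<dots> \<le> (C / s N)\<^sup>2 + 2 * (C / s N) * b N m"
        using hm b0 by (intro add_mono mult_right_mono mult_left_mono power_mono) auto
      finally show ?thesis .
    qed
    have "R N - Q N = (\<Sum>m<w N. (h N m + (- 1) ^ m * b N m)\<^sup>2 - (b N m)\<^sup>2) / s N"
      by (simp add: R_def Q_def sum_subtractf diff_divide_distrib)
    also have "\<bar>\<dots>\<bar> = \<bar>\<Sum>m<w N. (h N m + (- 1) ^ m * b N m)\<^sup>2 - (b N m)\<^sup>2\<bar> / s N"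
      using s_pos[of N] by simp
    also have "\<dots> \<le> (\<Sum>m<w N. (C / s N)\<^sup>2 + 2 * (C / s N) * b N m) / s N"
      using s_pos[of N] pt by (intro divide_right_mono order_trans[OF sum_abs] sum_mono) auto
    also have "\<dots> = (real (w N) * (C / s N)\<^sup>2 + 2 * (C / s N) * (\<Sum>m<w N. b N m)) / s N"
      by (simp add: sum.distrib sum_distrib_left)
    also have "\<dots> \<le> ((s N)\<^sup>2 * (C / s N)\<^sup>2 + 2 * (C / s N) * (D * B * s N)) / s N"
      using s_pos[of N] w[of N] C(1) sum_b[of N] s2[of N]
      by (intro divide_right_mono add_mono mult_right_mono mult_left_mono) auto
    also have "\<dots> = (C\<^sup>2 + 2 * C * D * B) * (1 / s N)"
      using s_pos[of N] by (simp add: power2_eq_square field_simps)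
    finally show ?thesis .
  qed
  have "(\<lambda>N. R N - Q N) \<longlonglongrightarrow> 0"
  proof (rule Lim_null_comparison)
    show "\<forall>\<^sub>F N in sequentially. norm (R N - Q N) \<le> (C\<^sup>2 + 2 * C * D * B) * (1 / s N)"
      using diff by simp
    have "(\<lambda>N. 1 / s N) \<longlonglongrightarrow> 0" unfolding s_def by real_asymp
    then show "(\<lambda>N. (C\<^sup>2 + 2 * C * D * B) * (1 / s N)) \<longlonglongrightarrow> 0"
      by (rule tendsto_mult_right_zero)
  qed
  moreover have "Q \<longlonglongrightarrow> (2 / sqrt 3) powr (3 / 2) / 2"
    unfolding Q_def b_def s_def using w w_top by (rule scaled_bulk_square_sum_limit)
  ultimately have "R \<longlonglongrightarrow> (2 / sqrt 3) powr (3 / 2) / 2"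
    using Lim_transform by blast
  then show ?thesis by (simp only: R_eq[abs_def] s_def)
qed

lemma cmod_fig8_torsion: "cmod (2 / csqrt (- 3)) = 2 / sqrt 3"
  by (simp add: norm_divide norm_mult)

lemma jones_top_sum_asymp:
  fixes w :: "nat \<Rightarrow> nat"
  assumes w: "\<And>N. w N \<le> N" and w_top: "filterlim (\<lambda>N. real (w N) / sqrt (real N + 1 / 2)) at_top sequentially"
  shows "(\<lambda>N. (eta_r (2 * N + 1))\<^sup>2 *
      (\<Sum>m<w N. (cmod (unnormalized_jones_fig8 (N - m) (jones_root N)))\<^sup>2)) \<sim>[at_top]
    (\<lambda>N. 1 / 4 * (real (2 * N + 1) / 2) powr (1 / 2) * cmod (2 / csqrt (- 3)) powr (3 / 2)
         * exp (real (2 * N + 1) / (2 * pi) * Vol_fig8))"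
proof (rule asymp_equivI')
  define L where "L = (2 / sqrt 3) powr (3 / 2)"
  have L: "L > 0" by (simp add: L_def)
  define S where "S = (\<lambda>N. \<Sum>m<w N. (jones_head N m + (- 1) ^ m * jones_bulk N m)\<^sup>2)"
  have target: "1 / 4 * (real (2 * N + 1) / 2) powr (1 / 2) * cmod (2 / csqrt (- 3)) powr (3 / 2)
         * exp (real (2 * N + 1) / (2 * pi) * Vol_fig8) = 1 / 4 * sqrt (real N + 1 / 2) * L * (peak N) ^ 4" for N
  proof -
    have "real (2 * N + 1) / 2 = real N + 1 / 2" by simp
    then have "(real (2 * N + 1) / 2) powr (1 / 2) = sqrt (real N + 1 / 2)"
      by (simp add: powr_half_sqrt)
    moreover have "exp (real (2 * N + 1) / (2 * pi) * Vol_fig8) = (peak N) ^ 4"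
      unfolding peak_def Vol_fig8_eq by (simp add: field_simps flip: exp_of_nat_mult)
    ultimately show ?thesis by (simp only: cmod_fig8_torsion L_def)
  qed
  have "(\<lambda>N. S N / ((peak N) ^ 4 * (sqrt (real N + 1 / 2)) ^ 3) * (2 / L)) \<longlonglongrightarrow> L / 2 * (2 / L)"
    unfolding S_def L_def by (intro tendsto_mult jones_square_sum_limit tendsto_const w w_top)
  moreover have "S N / ((peak N) ^ 4 * (sqrt (real N + 1 / 2)) ^ 3) * (2 / L) =
      (S N / (2 * (real N + 1 / 2))) / (1 / 4 * sqrt (real N + 1 / 2) * L * (peak N) ^ 4)" for N
  proof -
    define s where "s = sqrt (real N + 1 / 2)"
    have s: "s > 0" "real N + 1 / 2 = s * s" by (simp_all add: s_def)
    show ?thesis unfolding s_def[symmetric] unfolding s(2)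
      using s(1) L peak_pos[of N] by (simp add: power3_eq_cube field_simps)
  qed
  ultimately show "(\<lambda>N. (eta_r (2 * N + 1))\<^sup>2 *
      (\<Sum>m<w N. (cmod (unnormalized_jones_fig8 (N - m) (jones_root N)))\<^sup>2) /
      (1 / 4 * (real (2 * N + 1) / 2) powr (1 / 2) * cmod (2 / csqrt (- 3)) powr (3 / 2)
         * exp (real (2 * N + 1) / (2 * pi) * Vol_fig8))) \<longlonglongrightarrow> 1"
    unfolding target jones_square_sum[OF w] S_def using L by simp
qed

lemma TV_fig8_asymp:
  "(\<lambda>N. TV_fig8 (2 * N + 1)) \<sim>[at_top]
    (\<lambda>N. 1 / 4 * (real (2 * N + 1) / 2) powr (1 / 2) * cmod (2 / csqrt (- 3)) powr (3 / 2)
         * exp (real (2 * N + 1) / (2 * pi) * Vol_fig8))"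
proof -
  have "(\<Sum>M = 1..N. (cmod (unnormalized_jones_fig8 M (jones_root N)))\<^sup>2) =
      (\<Sum>m<N. (cmod (unnormalized_jones_fig8 (N - m) (jones_root N)))\<^sup>2)" for N
    by (rule sum.reindex_bij_witness[of _ "\<lambda>m. N - m" "\<lambda>M. N - M"]) auto
  then have "TV_fig8 (2 * N + 1) = (eta_r (2 * N + 1))\<^sup>2 *
      (\<Sum>m<N. (cmod (unnormalized_jones_fig8 (N - m) (jones_root N)))\<^sup>2)" for N
    unfolding TV_fig8_def Let_def by simp
  moreover have "filterlim (\<lambda>N. real N / sqrt (real N + 1 / 2)) at_top sequentially"
    by real_asymp
  ultimately show ?thesis
    using jones_top_sum_asymp[of "\<lambda>N. N"] by simp
qed

text \<open>
  The window consists of the \<open>M = N - m\<close> with \<open>m\<close> up to about \<open>\<delta> n\<close>, which is long on the scale \<open>\<surd>n\<close>. Hence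
  every window has the asymptotics of the full sum, however small \<open>\<delta>\<close> is.
\<close>

lemma jones_window_sum_asymp:
  fixes \<delta> :: real
  assumes \<delta>: "0 < \<delta>" "\<delta> \<le> 1"
  shows "(\<lambda>N. (eta_r (2 * N + 1))\<^sup>2 *
         (\<Sum>M | M \<in> {1..N} \<and> 1 - \<delta> \<le> real M / (real N + 1 / 2) \<and> real M / (real N + 1 / 2) \<le> 1.
            (cmod (unnormalized_jones_fig8 M (jones_root N)))\<^sup>2)) \<sim>[at_top]
    (\<lambda>N. 1 / 4 * (real (2 * N + 1) / 2) powr (1 / 2) * cmod (2 / csqrt (- 3)) powr (3 / 2)
         * exp (real (2 * N + 1) / (2 * pi) * Vol_fig8))"
proof -
  define w where "w = (\<lambda>N. min N (nat \<lfloor>\<delta> * (real N + 1 / 2) + 1 / 2\<rfloor>))"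
  have window: "m < w N \<longleftrightarrow> m < N \<and> 1 - \<delta> \<le> real (N - m) / (real N + 1 / 2)" for m N
  proof (cases "m < N")
    case True
    have "m < w N \<longleftrightarrow> int m + 1 \<le> \<lfloor>\<delta> * (real N + 1 / 2) + 1 / 2\<rfloor>"
      using True unfolding w_def by linarith
    also have "\<dots> \<longleftrightarrow> real m + 1 / 2 \<le> \<delta> * (real N + 1 / 2)"
      unfolding le_floor_iff by simp linarith
    also have "\<dots> \<longleftrightarrow> (1 - \<delta>) * (real N + 1 / 2) \<le> real (N - m)"
    proof -
      have "real m + 1 / 2 \<le> d \<longleftrightarrow> real N + 1 / 2 - d \<le> real N - real m" for d
        by linarith
      then show ?thesis
        unfolding left_diff_distrib of_nat_diff[OF less_imp_le[OF True]] by simp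
    qed
    also have "\<dots> \<longleftrightarrow> 1 - \<delta> \<le> real (N - m) / (real N + 1 / 2)"
      by (subst pos_le_divide_eq) auto
    finally show ?thesis using True by simp
  qed (simp add: w_def)
  have "filterlim (\<lambda>N. real (w N) / sqrt (real N + 1 / 2)) at_top sequentially"
  proof (rule filterlim_at_top_mono)
    show "filterlim (\<lambda>N. (\<delta> * real N - 1) / sqrt (real N + 1 / 2)) at_top sequentially"
      using \<delta>(1) by real_asymp
    have "\<delta> * real N - 1 \<le> real (w N)" for N
    proof -
      have "\<delta> * real N \<le> 1 * real N" using \<delta> by (intro mult_right_mono) auto
      moreover have "\<delta> * (real N + 1 / 2) = \<delta> * real N + \<delta> / 2" by (simp add: algebra_simps)
      ultimately show ?thesis using \<delta>(1) unfolding w_def by linarith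
    qed
    then show "\<forall>\<^sub>F N in sequentially. (\<delta> * real N - 1) / sqrt (real N + 1 / 2) \<le> real (w N) / sqrt (real N + 1 / 2)"
      by (intro always_eventually allI divide_right_mono) auto
  qed
  moreover have "(\<Sum>M | M \<in> {1..N} \<and> 1 - \<delta> \<le> real M / (real N + 1 / 2) \<and> real M / (real N + 1 / 2) \<le> 1.
            (cmod (unnormalized_jones_fig8 M (jones_root N)))\<^sup>2) =
      (\<Sum>m<w N. (cmod (unnormalized_jones_fig8 (N - m) (jones_root N)))\<^sup>2)" for N
    by (rule sum.reindex_bij_witness[of _ "\<lambda>m. N - m" "\<lambda>M. N - M"])
       (auto simp: window lessThan_iff)
  moreover have "w N \<le> N" for N by (simp add: w_def)
  ultimately show ?thesis using jones_top_sum_asymp[of w] by simp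
qed

text \<open>
  By \<open>jones_window_sum_asymp\<close> every \<open>\<delta>\<close> in \<open>(0, 1]\<close> will do.
\<close>

theorem theorem8:
  shows "\<exists>\<delta>::real. \<delta> > 0 \<and>
    (\<lambda>N::nat. TV_fig8 (2 * N + 1)) \<sim>[at_top]
      (\<lambda>N. (eta_r (2 * N + 1))\<^sup>2 *
         (\<Sum>M | M \<in> {1..N} \<and> 1 - \<delta> \<le> real M / (real N + 1 / 2) \<and> real M / (real N + 1 / 2) \<le> 1.
            (cmod (unnormalized_jones_fig8 M (jones_root N)))\<^sup>2)) \<and>
    (\<lambda>N::nat. TV_fig8 (2 * N + 1)) \<sim>[at_top]
      (\<lambda>N. 1 / 4 * (real (2 * N + 1) / 2) powr (1 / 2) * cmod (2 / csqrt (- 3)) powr (3 / 2)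
         * exp (real (2 * N + 1) / (2 * pi) * Vol_fig8))"
proof (intro exI[of _ "1 / 2"] conjI)
  have "0 < (1 / 2 :: real)" "1 / 2 \<le> (1 :: real)" by simp_all
  note window = jones_window_sum_asymp[OF this]
  show "(\<lambda>N::nat. TV_fig8 (2 * N + 1)) \<sim>[at_top]
      (\<lambda>N. (eta_r (2 * N + 1))\<^sup>2 *
         (\<Sum>M | M \<in> {1..N} \<and> 1 - 1 / 2 \<le> real M / (real N + 1 / 2) \<and> real M / (real N + 1 / 2) \<le> 1.
            (cmod (unnormalized_jones_fig8 M (jones_root N)))\<^sup>2))"
    using TV_fig8_asymp window[THEN asymp_equiv_symI] by (rule asymp_equiv_trans)
qed (use TV_fig8_asymp in simp_all)

end
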